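(* If there exists a selective ultrafilter $\mathcal U$ on $\omega$, then there exists a countably compact Hausdorff group topology on the free Abelian group of size continuum, i.e. on $\mathbb Z^{(\mathfrak c)}$.
   Context: $\omega$ is the set of natural numbers and $\mathfrak c$ is the cardinality of the continuum, regarded as an initial ordinal. $\mathbb Z^{(\mathfrak c)}$ is the group (under pointwise addition) of all functions $f:\mathfrak c\to\mathbb Z$ with finite support. $\omega^*$ denotes the set of free (non-principal) ultrafilters on $\omega$. An ultrafilter $\mathcal U\in\omega^*$ is selective if for each partition $\{A_n:n\in\omega\}$ of $\omega$ into non-empty sets, either $A_n\in\mathcal U$ for some $n\in\omega$, or for each $n\in\omega$ there exists $a_n\in A_n$ such that $\{a_n:n\in\omega\}\in\mathcal U$. A topological space $X$ is countably compact if every infinite subset of $X$ has an accumulation point in $X$. A group topology on a group is a topology making the group operation and inversion continuous. *)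

theory Defs
  imports "HOL-Analysis.Analysis" "HOL-Algebra.Free_Abelian_Groups"
begin

text \<open>Ultrafilters are taken as elements of the library type of filters; a set \<open>A\<close> belongs to the
  filter \<open>U\<close> iff \<open>\<forall>\<^sub>F n in U. n \<in> A\<close>.  Since that type contains the improper filter \<open>bot\<close>,
  properness has to be required.\<close>

definition ultrafilter :: "'a filter \<Rightarrow> bool" where
  "ultrafilter U \<longleftrightarrow>
     U \<noteq> bot \<and> (\<forall>A. (\<forall>\<^sub>F x in U. x \<in> A) \<or> (\<forall>\<^sub>F x in U. x \<in> - A))"

definition free_ultrafilter :: "'a filter \<Rightarrow> bool" where
  "free_ultrafilter U \<longleftrightarrow> ultrafilter U \<and> (\<forall>x. U \<noteq> principal {x})"

definition selective_ultrafilter :: "nat filter \<Rightarrow> bool" where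
  "selective_ultrafilter U \<longleftrightarrow>
     free_ultrafilter U \<and>
     (\<forall>A :: nat \<Rightarrow> nat set.
        disjoint_family A \<and> (\<Union>n. A n) = UNIV \<and> (\<forall>n. A n \<noteq> {}) \<longrightarrow>
          (\<exists>n. \<forall>\<^sub>F k in U. k \<in> A n) \<or>
          (\<exists>a. (\<forall>n. a n \<in> A n) \<and> (\<forall>\<^sub>F k in U. k \<in> range a)))"

text \<open>Countable compactness in the accumulation-point form; \<open>derived_set_of\<close> yields only
  accumulation points lying in the space.\<close>

definition countably_compact_space :: "'a topology \<Rightarrow> bool" where
  "countably_compact_space X \<longleftrightarrow>
     (\<forall>S. S \<subseteq> topspace X \<and> infinite S \<longrightarrow> X derived_set_of S \<noteq> {})"

definition group_topology :: "('a, 'b) monoid_scheme \<Rightarrow> 'a topology \<Rightarrow> bool" where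
  "group_topology G T \<longleftrightarrow>
     topspace T = carrier G \<and>
     continuous_map (prod_topology T T) T (\<lambda>(x, y). x \<otimes>\<^bsub>G\<^esub> y) \<and>
     continuous_map T T (\<lambda>x. inv\<^bsub>G\<^esub> x)"

end

theory Submission
  imports Defs "HOL-Real_Asymp.Real_Asymp"
begin

text \<open>Homomorphisms from the free Abelian group \<open>G\<close> on \<open>C\<close> to the circle group, below called characters, are
given by arbitrary real functions \<open>\<phi>\<close> on \<open>C\<close>: such a function extends to a linear form \<open>lin \<phi>\<close> on \<open>G\<close>,
which is read modulo 1.  Every set \<open>H\<close> of characters induces a group topology on \<open>G\<close>, and this
topology is Hausdorff as soon as \<open>H\<close> separates the elements of \<open>G\<close> from 0.  The task is to find an
\<open>H\<close> that is large enough for separation and small enough for sequences to accumulate.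

Let \<open>U\<close> be a selective ultrafilter, and well-order \<open>C\<close> in the order type of the continuum.  To many
generators \<open>\<xi>\<close> a sequence \<open>f \<xi>\<close> in \<open>G\<close> is attached whose terms are supported below \<open>\<xi>\<close>, and \<open>H\<close> consists of
the characters \<open>\<phi>\<close> for which \<open>\<phi> \<xi>\<close> is always the limit of \<open>lin \<phi> (f \<xi> n)\<close> along \<open>U\<close>, modulo 1.  In the
topology induced by \<open>H\<close>, the generator \<open>\<xi>\<close> is then the \<open>U\<close>-limit of \<open>f \<xi>\<close>; so the topology is countably
compact if every injective sequence in \<open>G\<close> has one of the \<open>f \<xi>\<close> as a subsequence.

For separation the sequences must not satisfy relations that their limits, being free generators,
violate.  This is ensured by making their classes in the ultrapower of \<open>G\<close> by \<open>U\<close> linearly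
independent modulo the constant sequences.  Such a choice is possible because an injective sequence
has continuum many subsequences that are pairwise distinct modulo \<open>U\<close>, whereas at each stage of the
transfinite recursion those that depend on the earlier choices fall into fewer than continuum
many countable families (\<open>exists_independent_family\<close>).

Independence suffices for separation, by a quantitative form of Kronecker's approximation theorem:
if integer vectors satisfy no nontrivial linear relation with coefficients bounded by a certain \<open>N\<close>,
where \<open>N\<close> depends only on the number of vectors and on \<open>\<epsilon>\<close>, then characters can be prescribed on them
up to \<open>\<epsilon>\<close> (\<open>quantitative_Kronecker\<close>).  Hence for \<open>U\<close>-almost all \<open>n\<close> one can change a given character by
less than \<open>\<epsilon>\<close> on finitely many generators and at the same time move its values at finitely many of
the \<open>f \<xi> n\<close> to within \<open>\<epsilon>\<close> of arbitrary targets.  The set of these \<open>n\<close> depends neither on the given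
character nor on the targets.  This uniformity is what selectivity exploits: a single set in \<open>U\<close>
can be enumerated such that each of its elements is good for the data determined by its
predecessor (\<open>selective_ultrafilter_diagonal_intersection\<close>), and successive corrections along
this set converge to a character on a countable set of generators that satisfies all limit
conditions there and does not vanish at a given nonzero element (\<open>countable_character\<close>).
The limit conditions themselves, read as a recursion along the well-order, extend this character
to all of \<open>C\<close> (\<open>extend_character\<close>).\<close>

section \<open>Ultrafilters\<close>

lemma ultrafilter_eventually_iff:
  assumes "ultrafilter U"
  shows "(\<forall>\<^sub>F x in U. x \<in> - A) \<longleftrightarrow> \<not> (\<forall>\<^sub>F x in U. x \<in> A)"
proof
  assume "\<forall>\<^sub>F x in U. x \<in> - A"
  show "\<not> (\<forall>\<^sub>F x in U. x \<in> A)"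
  proof
    assume "\<forall>\<^sub>F x in U. x \<in> A"
    with \<open>\<forall>\<^sub>F x in U. x \<in> - A\<close> have "\<forall>\<^sub>F x in U. False"
      by eventually_elim simp
    with assms show False by (simp add: ultrafilter_def)
  qed
next
  assume "\<not> (\<forall>\<^sub>F x in U. x \<in> A)"
  with assms show "\<forall>\<^sub>F x in U. x \<in> - A"
    unfolding ultrafilter_def by blast
qed

lemma ultrafilter_finite_union:
  assumes "ultrafilter U" "finite I" "\<forall>\<^sub>F x in U. \<exists>i\<in>I. x \<in> A i"
  shows "\<exists>i\<in>I. \<forall>\<^sub>F x in U. x \<in> A i"
proof (rule ccontr)
  assume "\<not> ?thesis"
  then have "\<forall>i\<in>I. \<forall>\<^sub>F x in U. x \<in> - A i"
    using ultrafilter_eventually_iff[OF assms(1)] by blast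
  then have "\<forall>\<^sub>F x in U. \<forall>i\<in>I. x \<in> - A i"
    using assms(2) by (simp add: eventually_ball_finite)
  with assms(3) have "\<forall>\<^sub>F x in U. False"
    by eventually_elim auto
  then show False
    using assms(1) by (simp add: ultrafilter_def)
qed

lemma free_ultrafilter_eventually_neq:
  assumes "free_ultrafilter U"
  shows "\<forall>\<^sub>F x in U. x \<noteq> a"
proof (rule ccontr)
  have U: "ultrafilter U" using assms by (simp add: free_ultrafilter_def)
  assume "\<not> ?thesis"
  then have a: "\<forall>\<^sub>F x in U. x \<in> {a}"
    using ultrafilter_eventually_iff[OF U, of "{a}"] by simp
  have "eventually P U \<longleftrightarrow> eventually P (principal {a})" for P
  proof
    assume "eventually P U"
    with a have "\<forall>\<^sub>F x in U. P a"
      by eventually_elim auto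
    then show "eventually P (principal {a})"
      using U by (cases "P a") (auto simp: eventually_principal ultrafilter_def)
  next
    assume "eventually P (principal {a})"
    then have "P a" by (simp add: eventually_principal)
    from a show "eventually P U"
      by (rule eventually_mono) (use \<open>P a\<close> in auto)
  qed
  then have "U = principal {a}" by (simp add: filter_eq_iff)
  with assms show False by (simp add: free_ultrafilter_def)
qed

lemma free_ultrafilter_eventually_notin_finite:
  fixes U :: "nat filter"
  assumes "free_ultrafilter U" "finite X"
  shows "\<forall>\<^sub>F n in U. n \<notin> X"
proof -
  have "\<forall>\<^sub>F n in U. \<forall>a\<in>X. n \<noteq> a"
    using assms free_ultrafilter_eventually_neq by (intro eventually_ball_finite) auto
  then show ?thesis by (rule eventually_mono) auto
qed

text \<open>If no point of \<open>K\<close> were a limit, each would have a neighbourhood whose preimage is \<open>U\<close>-null, and finitely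
many of these null sets would cover everything.\<close>

lemma ultrafilter_compact_limit:
  fixes f :: "'a \<Rightarrow> 'b::t2_space"
  assumes "ultrafilter U" "compact K" "\<And>n. f n \<in> K"
  shows "\<exists>l\<in>K. (f \<longlongrightarrow> l) U"
proof (rule ccontr)
  assume "\<not> ?thesis"
  then have "\<forall>l\<in>K. \<exists>S. open S \<and> l \<in> S \<and> \<not> (\<forall>\<^sub>F x in U. f x \<in> S)"
    by (simp add: tendsto_def)
  then obtain S where S: "\<And>l. l \<in> K \<Longrightarrow> open (S l) \<and> l \<in> S l \<and> \<not> (\<forall>\<^sub>F x in U. f x \<in> S l)"
    by metis
  obtain L where L: "L \<subseteq> K" "finite L" "K \<subseteq> (\<Union>l\<in>L. S l)"
    using compactE_image[OF assms(2), of K S] S by blast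
  have "\<forall>\<^sub>F x in U. \<exists>l\<in>L. x \<in> f -` S l"
    using L assms(3) by (intro always_eventually) blast
  then have "\<exists>l\<in>L. \<forall>\<^sub>F x in U. x \<in> f -` S l"
    by (rule ultrafilter_finite_union[OF assms(1) L(2)])
  with S L(1) show False by auto
qed

text \<open>This is the partition property for the partition into the fibres of \<open>F\<close>.  The partitions in the
definition of selectivity are indexed by all natural numbers and have nonempty parts, so the case of
finitely many fibres is treated separately; there any ultrafilter chooses one of them.\<close>

lemma selective_ultrafilter_constant_or_inj:
  fixes F :: "nat \<Rightarrow> nat"
  assumes "selective_ultrafilter U"
  shows "(\<exists>m. \<forall>\<^sub>F n in U. F n = m) \<or> (\<exists>X. (\<forall>\<^sub>F n in U. n \<in> X) \<and> inj_on F X)"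
proof (cases "finite (range F)")
  case True
  have U: "ultrafilter U"
    using assms by (simp add: selective_ultrafilter_def free_ultrafilter_def)
  have "\<forall>\<^sub>F n in U. \<exists>m\<in>range F. n \<in> F -` {m}" by simp
  from ultrafilter_finite_union[OF U True this] show ?thesis by auto
next
  case False
  define A where "A k = F -` {enumerate (range F) k}" for k
  have ex: "\<exists>k. F n = enumerate (range F) k" for n
    using enumerate_Ex[OF False rangeI[of F n]] by metis
  have "disjoint_family A"
    using inj_enumerate[OF False] by (fastforce simp: disjoint_family_on_def A_def inj_on_def)
  moreover have "(\<Union>k. A k) = UNIV"
    using ex by (auto simp: A_def)
  moreover have "A k \<noteq> {}" for k
    using enumerate_in_set[OF False, of k] by (auto simp: A_def)
  ultimately consider k where "\<forall>\<^sub>F n in U. n \<in> A k"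
    | a where "\<forall>k. a k \<in> A k" "\<forall>\<^sub>F n in U. n \<in> range a"
    using assms unfolding selective_ultrafilter_def by metis
  then show ?thesis
  proof cases
    case 1
    then show ?thesis by (auto simp: A_def)
  next
    case 2
    then have "F (a k) = enumerate (range F) k" for k by (auto simp: A_def)
    then have "inj_on F (range a)"
      using inj_enumerate[OF False] by (auto simp: inj_on_def)
    with 2 show ?thesis by blast
  qed
qed

text \<open>The statement is obtained from two applications of the dichotomy for functions.  The first one, to the
index at which \<open>k\<close> leaves the sets \<open>B n\<close>, yields a set in \<open>U\<close> that is almost contained in
every \<open>B n\<close>, with the finitely many exceptions below some \<open>h n\<close>.  The second one thins this set out so
that consecutive elements \<open>a < b\<close> satisfy \<open>h a \<le> b\<close>: the natural numbers are cut into intervals with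
endpoints \<open>0, h 0, h (h 0), \<dots>\<close>, and one keeps at most one element in each interval, using only the
intervals whose number has a fixed parity.\<close>

lemma selective_ultrafilter_diagonal_intersection:
  fixes B :: "nat \<Rightarrow> nat set"
  assumes sel: "selective_ultrafilter U" and B: "\<And>n. \<forall>\<^sub>F k in U. k \<in> B n"
  obtains A where "\<forall>\<^sub>F k in U. k \<in> A" "\<And>a b. a \<in> A \<Longrightarrow> b \<in> A \<Longrightarrow> a < b \<Longrightarrow> b \<in> B a"
proof -
  have free: "free_ultrafilter U" using sel by (simp add: selective_ultrafilter_def)
  have U: "ultrafilter U" using free by (simp add: free_ultrafilter_def)
  \<comment> \<open>The alternative \<open>k \<le> n\<close> makes the minimum exist when \<open>k\<close> lies in every \<open>B n\<close>.\<close>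
  define F where "F k = (LEAST n. k \<notin> B n \<or> k \<le> n)" for k
  have F: "k \<notin> B (F k) \<or> k \<le> F k" and F_least: "n < F k \<Longrightarrow> k \<in> B n" for k n
    unfolding F_def by (rule LeastI[of _ k], simp) (use not_less_Least in blast)
  have "\<not> (\<forall>\<^sub>F k in U. F k = m)" for m
  proof
    assume "\<forall>\<^sub>F k in U. F k = m"
    moreover note B[of m] free_ultrafilter_eventually_notin_finite[OF free finite_atMost[of m]]
    ultimately have "\<forall>\<^sub>F k in U. False"
      by eventually_elim (use F in fastforce)
    then show False using U by (simp add: ultrafilter_def)
  qed
  then obtain X where X: "\<forall>\<^sub>F n in U. n \<in> X" "inj_on F X"
    using selective_ultrafilter_constant_or_inj[OF sel] by blast
  have "finite {k\<in>X. F k \<le> n}" for n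
    using finite_vimage_IntI[OF finite_atMost[of n] X(2)] by (rule rev_finite_subset) auto
  then have "\<exists>h. \<forall>k\<in>X. F k \<le> n \<longrightarrow> k \<le> h" for n
    by (metis (mono_tags, lifting) finite_nat_set_iff_bounded_le mem_Collect_eq)
  then obtain h0 where h0: "\<And>n k. k \<in> X \<Longrightarrow> F k \<le> n \<Longrightarrow> k \<le> h0 n"
    by metis
  define h where "h n = Suc n + (\<Sum>i\<le>n. h0 i)" for n
  have h_mono: "m \<le> n \<Longrightarrow> h m \<le> h n" for m n
    unfolding h_def by (intro add_mono sum_mono2) auto
  have h_B: "k \<in> B n" if "k \<in> X" "h n \<le> k" for k n
  proof -
    have "h0 n \<le> (\<Sum>i\<le>n. h0 i)" by (rule member_le_sum) auto
    with that have "h0 n < k" by (simp add: h_def)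
    with h0[OF that(1)] have "n < F k" by (meson not_less)
    then show ?thesis by (rule F_least)
  qed
  define x where "x k = (h ^^ k) 0" for k
  have x_Suc: "x (Suc k) = h (x k)" for k by (simp add: x_def)
  have x_mono: "strict_mono x"
    by (rule strict_monoI_Suc) (simp add: x_Suc h_def)
  define G where "G n = (LEAST k. n < x (Suc k))" for n
  have G: "n < x (Suc (G n))" for n
    unfolding G_def
  proof (rule LeastI)
    show "n < x (Suc n)" using strict_mono_imp_increasing[OF x_mono, of "Suc n"] by simp
  qed
  have G_le: "x (G n) \<le> n" for n
  proof (cases "G n")
    case 0
    then show ?thesis by (simp add: x_def)
  next
    case (Suc j)
    then have "\<not> n < x (Suc j)" using not_less_Least[of j "\<lambda>k. n < x (Suc k)"] by (simp add: G_def)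
    with Suc show ?thesis by simp
  qed
  have "\<not> (\<forall>\<^sub>F k in U. G k = m)" for m
  proof
    assume "\<forall>\<^sub>F k in U. G k = m"
    moreover note free_ultrafilter_eventually_notin_finite[OF free finite_lessThan[of "x (Suc m)"]]
    ultimately have "\<forall>\<^sub>F k in U. False"
      by eventually_elim (use G in fastforce)
    then show False using U by (simp add: ultrafilter_def)
  qed
  then obtain Y where Y: "\<forall>\<^sub>F n in U. n \<in> Y" "inj_on G Y"
    using selective_ultrafilter_constant_or_inj[OF sel] by blast
  have "\<forall>\<^sub>F n in U. \<exists>p\<in>{0,1}. n \<in> {n. G n mod 2 = p}"
    by (intro always_eventually allI) (auto simp: mod2_eq_if)
  from ultrafilter_finite_union[OF U _ this]
  obtain p where p: "\<forall>\<^sub>F n in U. G n mod 2 = p" by auto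
  show thesis
  proof
    show "\<forall>\<^sub>F k in U. k \<in> X \<inter> Y \<inter> {n. G n mod 2 = p}"
      using X(1) Y(1) p by eventually_elim auto
  next
    fix a b assume a: "a \<in> X \<inter> Y \<inter> {n. G n mod 2 = p}" and b: "b \<in> X \<inter> Y \<inter> {n. G n mod 2 = p}"
      and "a < b"
    have "G a \<noteq> G b" using a b \<open>a < b\<close> Y(2) by (auto simp: inj_on_def)
    moreover have "G a \<le> G b"
    proof (rule ccontr)
      assume "\<not> G a \<le> G b"
      then have "x (Suc (G b)) \<le> x (G a)" using strict_mono_less_eq[OF x_mono] by simp
      with G[of b] G_le[of a] \<open>a < b\<close> show False by simp
    qed
    moreover have "G a mod 2 = G b mod 2" using a b by simp
    ultimately have "Suc (Suc (G a)) \<le> G b" by presburger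
    then have "x (Suc (Suc (G a))) \<le> x (G b)" using strict_mono_less_eq[OF x_mono] by simp
    moreover have "h a \<le> x (Suc (Suc (G a)))"
      unfolding x_Suc[of "Suc (G a)"] using G[of a] by (intro h_mono) simp
    ultimately have "h a \<le> b" using G_le[of b] by simp
    with b show "b \<in> B a" using h_B by blast
  qed
qed

section \<open>Characters of free Abelian groups\<close>

definition lin :: "('c \<Rightarrow> real) \<Rightarrow> ('c \<Rightarrow>\<^sub>0 int) \<Rightarrow> real" where
  "lin \<phi> x = (\<Sum>c\<in>Poly_Mapping.keys x. of_int (Poly_Mapping.lookup x c) * \<phi> c)"

lemma lin_superset:
  assumes "finite S" "Poly_Mapping.keys x \<subseteq> S"
  shows "lin \<phi> x = (\<Sum>c\<in>S. of_int (Poly_Mapping.lookup x c) * \<phi> c)"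
  unfolding lin_def using assms by (intro sum.mono_neutral_left) (auto simp: in_keys_iff)

lemma lin_0 [simp]: "lin \<phi> 0 = 0"
  by (simp add: lin_def)

lemma lin_frag_of [simp]: "lin \<phi> (frag_of c) = \<phi> c"
  by (simp add: lin_def)

lemma lin_add: "lin \<phi> (x + y) = lin \<phi> x + lin \<phi> y"
proof -
  let ?S = "Poly_Mapping.keys x \<union> Poly_Mapping.keys y"
  have "lin \<phi> (x + y) = (\<Sum>c\<in>?S. of_int (Poly_Mapping.lookup (x + y) c) * \<phi> c)"
    by (rule lin_superset) (auto simp: keys_add)
  also have "\<dots> = lin \<phi> x + lin \<phi> y"
    by (simp add: lin_superset[of ?S] lookup_add distrib_right sum.distrib)
  finally show ?thesis .
qed

lemma lin_minus: "lin \<phi> (- x) = - lin \<phi> x"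
  by (simp add: lin_def sum_negf)

lemma lin_diff: "lin \<phi> (x - y) = lin \<phi> x - lin \<phi> y"
  using lin_add[of \<phi> x "- y"] by (simp add: lin_minus)

lemma lin_cmul: "lin \<phi> (frag_cmul k x) = of_int k * lin \<phi> x"
proof -
  have "lin \<phi> (frag_cmul k x) =
      (\<Sum>c\<in>Poly_Mapping.keys x. of_int (Poly_Mapping.lookup (frag_cmul k x) c) * \<phi> c)"
    by (rule lin_superset) (auto simp: keys_cmul)
  then show ?thesis by (simp add: lin_def sum_distrib_left mult.assoc)
qed

lemma lin_sum: "lin \<phi> (sum f A) = (\<Sum>a\<in>A. lin \<phi> (f a))"
  by (induction A rule: infinite_finite_induct) (auto simp: lin_add)

lemma lin_cong: "(\<And>c. c \<in> Poly_Mapping.keys x \<Longrightarrow> \<phi> c = \<psi> c) \<Longrightarrow> lin \<phi> x = lin \<psi> x"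
  by (simp add: lin_def)

text \<open>The Lipschitz constant of evaluation at \<open>x\<close> with respect to uniform distance on the support of \<open>x\<close>.\<close>

definition l1 :: "('c \<Rightarrow>\<^sub>0 int) \<Rightarrow> real" where
  "l1 x = (\<Sum>c\<in>Poly_Mapping.keys x. \<bar>of_int (Poly_Mapping.lookup x c)\<bar>)"

lemma l1_nonneg: "0 \<le> l1 x"
  by (simp add: l1_def sum_nonneg)

lemma lin_approx:
  assumes "\<And>c. c \<in> Poly_Mapping.keys x \<Longrightarrow> \<bar>\<phi> c - \<psi> c\<bar> \<le> d"
  shows "\<bar>lin \<phi> x - lin \<psi> x\<bar> \<le> l1 x * d"
proof -
  have "lin \<phi> x - lin \<psi> x = (\<Sum>c\<in>Poly_Mapping.keys x. of_int (Poly_Mapping.lookup x c) * (\<phi> c - \<psi> c))"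
    by (simp add: lin_def sum_subtractf right_diff_distrib)
  also have "\<bar>\<dots>\<bar> \<le> (\<Sum>c\<in>Poly_Mapping.keys x. \<bar>of_int (Poly_Mapping.lookup x c) * (\<phi> c - \<psi> c)\<bar>)"
    by (rule sum_abs)
  also have "\<dots> \<le> (\<Sum>c\<in>Poly_Mapping.keys x. \<bar>of_int (Poly_Mapping.lookup x c)\<bar> * d)"
    using assms by (intro sum_mono) (simp add: abs_mult mult_left_mono)
  finally show ?thesis by (simp add: l1_def sum_distrib_right)
qed

abbreviation circ :: "real \<Rightarrow> complex" where
  "circ t \<equiv> cis (2 * pi * t)"

lemma circ_add: "circ (s + t) = circ s * circ t"
  by (simp add: cis_mult ring_distribs)

lemma circ_diff: "circ (s - t) = circ s * circ (- t)"
  by (simp only: diff_conv_add_uminus circ_add)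

lemma circ_sum: "circ (sum f A) = (\<Prod>a\<in>A. circ (f a))"
proof (induction A rule: infinite_finite_induct)
  case (insert x F)
  then show ?case by (simp only: sum.insert prod.insert circ_add not_False_eq_True)
qed auto

lemma circ_eq_1_iff: "circ t = 1 \<longleftrightarrow> (\<exists>p::int. t = p)"
proof
  assume "circ t = 1"
  then have "cos (2 * pi * t) = 1" by (metis cis.sel(1) one_complex.sel(1))
  then obtain p :: int where "2 * pi * t = of_int p * 2 * pi" by (auto simp: cos_one_2pi_int)
  then have "t = of_int p" by simp
  then show "\<exists>p::int. t = p" ..
qed (auto simp: cis_multiple_2pi)

lemma tendsto_circ_mod_1:
  assumes "\<And>d. 0 < d \<Longrightarrow> \<forall>\<^sub>F n in F. \<exists>p::int. \<bar>s n - t - of_int p\<bar> < d"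
  shows "((\<lambda>n. circ (s n)) \<longlongrightarrow> circ t) F"
proof (rule tendstoI)
  fix e :: real assume "0 < e"
  have "isCont circ 0"
    unfolding isCont_def by (intro tendsto_cis tendsto_mult tendsto_const tendsto_ident_at)
  then obtain d where d: "0 < d" "\<And>u. \<bar>u\<bar> < d \<Longrightarrow> dist (circ u) 1 < e"
    using \<open>0 < e\<close> unfolding continuous_at_eps_delta by (auto simp: dist_real_def)
  from assms[OF d(1)] show "\<forall>\<^sub>F n in F. dist (circ (s n)) (circ t) < e"
  proof eventually_elim
    case (elim n)
    then obtain p :: int where p: "\<bar>s n - t - of_int p\<bar> < d" by blast
    have "circ (of_int p) = 1" unfolding circ_eq_1_iff by blast
    then have "circ (s n) = circ t * circ (s n - t - of_int p)"
      using circ_add[of "t + of_int p" "s n - t - of_int p"] circ_add[of t "of_int p"] by simp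
    then have "circ (s n) - circ t = circ t * (circ (s n - t - of_int p) - 1)"
      by (simp add: right_diff_distrib)
    then have "dist (circ (s n)) (circ t) = dist (circ (s n - t - of_int p)) 1"
      by (simp only: dist_norm norm_mult norm_cis mult_1)
    with d(2)[OF p] show ?case by simp
  qed
qed

section \<open>A quantitative form of Kronecker's theorem\<close>

lemma sum_circ_residues_eq_0:
  fixes d :: int and q :: nat
  assumes "d \<noteq> 0" "\<bar>d\<bar> < int q"
  shows "(\<Sum>i<q. circ (of_int d * (real i / real q))) = 0"
proof -
  let ?z = "circ (of_int d / real q)"
  have q: "0 < q" using assms by simp
  have "circ (of_int d * (real i / real q)) = ?z ^ i" for i
    by (simp add: Complex.DeMoivre mult_ac)
  moreover have "?z \<noteq> 1"
  proof
    assume "?z = 1"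
    then obtain p :: int where "of_int d / real q = of_int p" unfolding circ_eq_1_iff by blast
    then have "real_of_int d = of_int (p * int q)" using q by (simp add: field_simps)
    then have "d = p * int q" by linarith
    with assms show False by (simp add: abs_mult)
  qed
  moreover have "?z ^ q = 1"
  proof -
    have "?z ^ q = circ (of_int d)" using q by (simp add: Complex.DeMoivre)
    also have "\<dots> = 1" unfolding circ_eq_1_iff by blast
    finally show ?thesis .
  qed
  ultimately show ?thesis by (simp add: geometric_sum)
qed

lemma sum_characters_eq_0:
  fixes x :: "'c \<Rightarrow>\<^sub>0 int"
  assumes S: "finite S" "Poly_Mapping.keys x \<subseteq> S" and "x \<noteq> 0"
    and q: "\<And>c. \<bar>Poly_Mapping.lookup x c\<bar> < int q"
  shows "(\<Sum>b\<in>S \<rightarrow>\<^sub>E {..<q}. circ (lin (\<lambda>c. real (b c) / real q) x)) = 0"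
proof -
  obtain c where c: "c \<in> Poly_Mapping.keys x" using \<open>x \<noteq> 0\<close> by (metis equals0I keys_eq_empty)
  have "(\<Sum>b\<in>S \<rightarrow>\<^sub>E {..<q}. circ (lin (\<lambda>c. real (b c) / real q) x)) =
      (\<Sum>b\<in>S \<rightarrow>\<^sub>E {..<q}. \<Prod>c\<in>S. circ (of_int (Poly_Mapping.lookup x c) * (real (b c) / real q)))"
    by (simp only: lin_superset[OF S] circ_sum)
  also have "\<dots> = (\<Prod>c\<in>S. \<Sum>i<q. circ (of_int (Poly_Mapping.lookup x c) * (real i / real q)))"
    by (rule prod_sum_PiE[symmetric]) (use S in auto)
  also have "\<dots> = 0"
    using S c q sum_circ_residues_eq_0[of "Poly_Mapping.lookup x c" q]
    by (intro prod_zero) (auto simp: in_keys_iff)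
  finally show ?thesis .
qed

text \<open>Averaged over the characters whose values are \<open>q\<close>-th roots of unity, the squared modulus of the trigonometric
polynomial on the right equals the sum on the left (Parseval).  For this, \<open>q\<close> has to
be larger than all coefficients of the differences \<open>x a - x b\<close>, so that these remain nonzero modulo \<open>q\<close>.\<close>

lemma exists_character_large:
  fixes x :: "'a \<Rightarrow> ('c \<Rightarrow>\<^sub>0 int)" and w :: "'a \<Rightarrow> complex"
  assumes fin: "finite \<Omega>" and inj: "inj_on x \<Omega>"
  shows "\<exists>\<phi>. (\<Sum>a\<in>\<Omega>. (cmod (w a))\<^sup>2) \<le> (cmod (\<Sum>a\<in>\<Omega>. w a * circ (lin \<phi> (x a))))\<^sup>2"
proof (rule ccontr)
  assume no: "\<not> ?thesis"
  define S where "S = (\<Union>a\<in>\<Omega>. Poly_Mapping.keys (x a))"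
  define q where "q = Suc (\<Sum>a\<in>\<Omega>. \<Sum>b\<in>\<Omega>. \<Sum>c\<in>S. nat \<bar>Poly_Mapping.lookup (x a - x b) c\<bar>)"
  have S: "finite S" using fin by (simp add: S_def)
  have keys: "Poly_Mapping.keys (x a - x b) \<subseteq> S" if "a \<in> \<Omega>" "b \<in> \<Omega>" for a b
    using that keys_diff[of "x a" "x b"] by (auto simp: S_def)
  have q: "\<bar>Poly_Mapping.lookup (x a - x b) c\<bar> < int q" if "a \<in> \<Omega>" "b \<in> \<Omega>" for a b c
  proof (cases "c \<in> S")
    case True
    have "nat \<bar>Poly_Mapping.lookup (x a - x b) c\<bar> \<le> (\<Sum>c\<in>S. nat \<bar>Poly_Mapping.lookup (x a - x b) c\<bar>)"
      using True S by (intro member_le_sum) auto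
    also have "\<dots> \<le> (\<Sum>b\<in>\<Omega>. \<Sum>c\<in>S. nat \<bar>Poly_Mapping.lookup (x a - x b) c\<bar>)"
      using that fin by (intro member_le_sum[of b \<Omega> "\<lambda>b. \<Sum>c\<in>S. nat \<bar>Poly_Mapping.lookup (x a - x b) c\<bar>"]) auto
    also have "\<dots> \<le> (\<Sum>a\<in>\<Omega>. \<Sum>b\<in>\<Omega>. \<Sum>c\<in>S. nat \<bar>Poly_Mapping.lookup (x a - x b) c\<bar>)"
      using that fin
      by (intro member_le_sum[of a \<Omega> "\<lambda>a. \<Sum>b\<in>\<Omega>. \<Sum>c\<in>S. nat \<bar>Poly_Mapping.lookup (x a - x b) c\<bar>"]) auto
    finally have "nat \<bar>Poly_Mapping.lookup (x a - x b) c\<bar> < q" by (simp only: q_def less_Suc_eq_le)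
    then show ?thesis by linarith
  next
    case False
    with keys[OF that] have "Poly_Mapping.lookup (x a - x b) c = 0" by (auto simp: in_keys_iff)
    moreover have "0 < q" unfolding q_def by (rule zero_less_Suc)
    ultimately show ?thesis by simp
  qed
  define \<Phi> where "\<Phi> = S \<rightarrow>\<^sub>E {..<q}"
  define \<theta> where "\<theta> b = (\<lambda>c. real (b c) / real q)" for b :: "'c \<Rightarrow> nat"
  define P where "P \<phi> = (\<Sum>a\<in>\<Omega>. w a * circ (lin \<phi> (x a)))" for \<phi>
  have \<Phi>: "finite \<Phi>" "\<Phi> \<noteq> {}"
    using S by (auto simp: \<Phi>_def finite_PiE PiE_eq_empty_iff q_def lessThan_empty_iff)
  have swap: "u * s * (v * t) = u * v * (s * t)" for u s v t :: complex
    by simp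
  have P_sq: "complex_of_real ((cmod (P \<phi>))\<^sup>2) =
      (\<Sum>a\<in>\<Omega>. \<Sum>b\<in>\<Omega>. w a * cnj (w b) * circ (lin \<phi> (x a - x b)))" for \<phi>
  proof -
    have "complex_of_real ((cmod (P \<phi>))\<^sup>2) = P \<phi> * cnj (P \<phi>)"
      by (metis complex_norm_square of_real_power)
    also have "\<dots> = (\<Sum>a\<in>\<Omega>. \<Sum>b\<in>\<Omega>. w a * circ (lin \<phi> (x a)) * (cnj (w b) * circ (- lin \<phi> (x b))))"
      by (simp add: P_def sum_product cis_cnj)
    also have "\<dots> = (\<Sum>a\<in>\<Omega>. \<Sum>b\<in>\<Omega>. w a * cnj (w b) * circ (lin \<phi> (x a - x b)))"
      by (intro sum.cong refl) (simp only: lin_diff circ_diff swap)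
    finally show ?thesis .
  qed
  have orth: "(\<Sum>\<phi>\<in>\<Phi>. circ (lin (\<theta> \<phi>) (x a - x b))) = (if a = b then of_nat (card \<Phi>) else 0)"
    if "a \<in> \<Omega>" "b \<in> \<Omega>" for a b
  proof (cases "a = b")
    case False
    then have "x a - x b \<noteq> 0" using inj that by (auto simp: inj_on_def)
    from sum_characters_eq_0[OF S keys[OF that] this q[OF that]] False
    show ?thesis by (simp add: \<Phi>_def \<theta>_def)
  qed simp
  have "complex_of_real (\<Sum>\<phi>\<in>\<Phi>. (cmod (P (\<theta> \<phi>)))\<^sup>2) =
      (\<Sum>\<phi>\<in>\<Phi>. \<Sum>a\<in>\<Omega>. \<Sum>b\<in>\<Omega>. w a * cnj (w b) * circ (lin (\<theta> \<phi>) (x a - x b)))"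
    unfolding of_real_sum P_sq ..
  also have "\<dots> = (\<Sum>a\<in>\<Omega>. \<Sum>b\<in>\<Omega>. w a * cnj (w b) * (\<Sum>\<phi>\<in>\<Phi>. circ (lin (\<theta> \<phi>) (x a - x b))))"
    by (subst sum.swap, intro sum.cong refl, subst sum.swap) (simp add: sum_distrib_left)
  also have "\<dots> = (\<Sum>a\<in>\<Omega>. \<Sum>b\<in>\<Omega>. if b = a then w a * cnj (w a) * of_nat (card \<Phi>) else 0)"
    by (intro sum.cong refl) (auto simp: orth)
  also have "\<dots> = (\<Sum>a\<in>\<Omega>. w a * cnj (w a) * of_nat (card \<Phi>))"
    using fin by simp
  also have "\<dots> = complex_of_real (real (card \<Phi>) * (\<Sum>a\<in>\<Omega>. (cmod (w a))\<^sup>2))"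
    by (simp add: complex_norm_square[symmetric] sum_distrib_left mult_ac)
  finally have "(\<Sum>\<phi>\<in>\<Phi>. (cmod (P (\<theta> \<phi>)))\<^sup>2) = real (card \<Phi>) * (\<Sum>a\<in>\<Omega>. (cmod (w a))\<^sup>2)"
    by (simp only: of_real_eq_iff)
  moreover have "(\<Sum>\<phi>\<in>\<Phi>. (cmod (P (\<theta> \<phi>)))\<^sup>2) < (\<Sum>\<phi>\<in>\<Phi>. (\<Sum>a\<in>\<Omega>. (cmod (w a))\<^sup>2))"
    using \<Phi> no by (intro sum_strict_mono) (auto simp: P_def not_le)
  ultimately show False by simp
qed

lemma norm_one_plus_circ_bound:
  assumes "0 < (\<delta>::real)"
  shows "\<exists>\<kappa>. 0 < \<kappa> \<and> \<kappa> < 1 \<and> (\<forall>s. (\<forall>p::int. \<delta> \<le> \<bar>s - of_int p\<bar>) \<longrightarrow> (cmod (1 + circ s))\<^sup>2 \<le> 4 * \<kappa>)"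
proof -
  define d where "d = min \<delta> (1/4)"
  have d: "0 < d" "d \<le> 1/4" "d \<le> \<delta>" using assms by (auto simp: d_def)
  define \<kappa> where "\<kappa> = (1 + cos (2 * pi * d)) / 2"
  have "cos (2 * pi * d) < cos 0"
    using d by (intro cos_monotone_0_pi) auto
  moreover have "0 \<le> cos (2 * pi * d)"
    using d by (intro cos_ge_zero) (auto simp: field_simps intro: order_trans[of _ 0])
  ultimately have "0 < \<kappa>" "\<kappa> < 1" by (auto simp: \<kappa>_def)
  moreover have "(cmod (1 + circ s))\<^sup>2 \<le> 4 * \<kappa>" if s: "\<forall>p::int. \<delta> \<le> \<bar>s - of_int p\<bar>" for s
  proof -
    define r where "r = \<bar>s - round s\<bar>"
    have "d \<le> r" using s d(3) unfolding r_def by (meson order_trans)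
    moreover have "r \<le> 1/2" using of_int_round_abs_le[of s] by (simp add: r_def abs_minus_commute)
    ultimately have r: "d \<le> r" "r \<le> 1/2" by auto
    have "cos (2 * pi * s) = cos (2 * pi * (s - round s))"
    proof -
      have "circ s = circ (s - round s) * circ (round s)"
        by (simp only: circ_add[symmetric] diff_add_cancel)
      moreover have "circ (round s) = 1" unfolding circ_eq_1_iff by blast
      ultimately have "circ s = circ (s - round s)" by simp
      then show ?thesis by (metis cis.sel(1))
    qed
    also have "\<dots> = cos (2 * pi * r)"
    proof -
      have "2 * pi * r = \<bar>2 * pi * (s - round s)\<bar>" by (simp add: r_def abs_mult)
      then show ?thesis by (simp only: cos_abs_real)
    qed
    also have "\<dots> \<le> cos (2 * pi * d)"
      using r d by (intro cos_monotone_0_pi_le) auto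
    finally have "cos (2 * pi * s) \<le> cos (2 * pi * d)" .
    moreover have "(cmod (1 + circ s))\<^sup>2 = 2 + 2 * cos (2 * pi * s)"
    proof -
      have "(cmod (1 + circ s))\<^sup>2 = (1 + cos (2 * pi * s))\<^sup>2 + (sin (2 * pi * s))\<^sup>2"
        by (simp add: cmod_power2)
      also have "\<dots> = 1 + 2 * cos (2 * pi * s) + ((sin (2 * pi * s))\<^sup>2 + (cos (2 * pi * s))\<^sup>2)"
        by (simp add: power2_eq_square algebra_simps)
      finally show ?thesis by (simp only: sin_cos_squared_add)
    qed
    ultimately show ?thesis by (simp add: \<kappa>_def)
  qed
  ultimately show ?thesis by blast
qed

lemma exponential_beats_polynomial:
  fixes \<kappa> :: real
  assumes "0 < \<kappa>" "\<kappa> < 1"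
  shows "\<exists>N::nat. real (Suc N) ^ K * \<kappa> ^ N < 1"
proof -
  have "(\<lambda>n. real (Suc n) ^ K * \<kappa> ^ n) \<longlonglongrightarrow> 0"
    using assms by real_asymp
  from order_tendstoD(2)[OF this, of 1] show ?thesis
    by (auto simp: eventually_sequentially)
qed

text \<open>The polynomial \<open>\<Prod>(1 + z\<^sub>j)\<^sup>N\<close> on the torus has modulus at most \<open>2 ^ (N * card J)\<close>, and smaller by a factor
exponential in \<open>N\<close> as soon as some \<open>z\<^sub>j\<close> is far from 1.  It is evaluated at \<open>z\<^sub>j = circ (lin \<phi> (v j) - t j)\<close>.  If there are no relations with coefficients up
to \<open>N\<close>, then its \<open>(N + 1) ^ card J\<close> monomials restrict to distinct characters.  By Parseval and the Cauchy-Schwarz inequality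
its squared modulus is therefore at some character at least \<open>4 ^ (N * card J)\<close> divided by the number of
monomials.  For large \<open>N\<close>, losing only a factor polynomial in \<open>N\<close> is possible only if all
\<open>z\<^sub>j\<close> are close to 1.\<close>

lemma quantitative_Kronecker:
  fixes J :: "'j set"
  assumes J: "finite J" and \<delta>: "0 < \<delta>"
  shows "\<exists>N::nat. \<forall>(v :: 'j \<Rightarrow> ('c \<Rightarrow>\<^sub>0 int)).
    (\<forall>m. (\<forall>j\<in>J. \<bar>m j\<bar> \<le> int N) \<and> (\<Sum>j\<in>J. frag_cmul (m j) (v j)) = 0 \<longrightarrow> (\<forall>j\<in>J. m j = 0)) \<longrightarrow>
    (\<forall>t. \<exists>\<phi>. \<forall>j\<in>J. \<exists>p::int. \<bar>lin \<phi> (v j) - t j - of_int p\<bar> < \<delta>)"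
proof -
  obtain \<kappa> where \<kappa>: "0 < \<kappa>" "\<kappa> < 1"
    and far: "\<And>s. (\<And>p::int. \<delta> \<le> \<bar>s - of_int p\<bar>) \<Longrightarrow> (cmod (1 + circ s))\<^sup>2 \<le> 4 * \<kappa>"
    using norm_one_plus_circ_bound[OF \<delta>] by blast
  obtain N :: nat where N: "real (Suc N) ^ card J * \<kappa> ^ N < 1"
    using exponential_beats_polynomial[OF \<kappa>] by blast
  have "\<exists>\<phi>. \<forall>j\<in>J. \<exists>p::int. \<bar>lin \<phi> (v j) - t j - of_int p\<bar> < \<delta>"
    if indep: "\<And>m j. (\<And>j. j \<in> J \<Longrightarrow> \<bar>m j\<bar> \<le> int N) \<Longrightarrow> (\<Sum>j\<in>J. frag_cmul (m j) (v j)) = 0 \<Longrightarrow> j \<in> J \<Longrightarrow> m j = 0"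
    for v :: "'j \<Rightarrow> ('c \<Rightarrow>\<^sub>0 int)" and t
  proof (rule ccontr)
    assume no: "\<not> ?thesis"
    define \<Omega> where "\<Omega> = J \<rightarrow>\<^sub>E {..N}"
    define x where "x a = (\<Sum>j\<in>J. frag_cmul (int (a j)) (v j))" for a :: "'j \<Rightarrow> nat"
    define w where "w a = (\<Prod>j\<in>J. of_nat (N choose a j) * circ (- (real (a j) * t j)))" for a :: "'j \<Rightarrow> nat"
    define P where "P \<phi> = (\<Prod>j\<in>J. (1 + circ (lin \<phi> (v j) - t j)) ^ N)" for \<phi>
    have \<Omega>: "finite \<Omega>" "card \<Omega> = Suc N ^ card J"
      using J by (auto simp: \<Omega>_def finite_PiE card_PiE)
    have "inj_on x \<Omega>"
    proof (rule inj_onI)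
      fix a b assume a: "a \<in> \<Omega>" and b: "b \<in> \<Omega>" and "x a = x b"
      then have "(\<Sum>j\<in>J. frag_cmul (int (a j) - int (b j)) (v j)) = 0"
        by (simp add: x_def frag_cmul_diff_distrib sum_subtractf)
      moreover have "\<bar>int (a j) - int (b j)\<bar> \<le> int N" if "j \<in> J" for j
        using PiE_mem[OF a[unfolded \<Omega>_def] that] PiE_mem[OF b[unfolded \<Omega>_def] that] by auto
      ultimately have "a j = b j" if "j \<in> J" for j
        using indep[of "\<lambda>j. int (a j) - int (b j)" j] that by simp
      with a b show "a = b" unfolding \<Omega>_def by (rule PiE_ext)
    qed
    from exists_character_large[OF \<Omega>(1) this, of w]
    obtain \<phi> where \<phi>: "(\<Sum>a\<in>\<Omega>. (cmod (w a))\<^sup>2) \<le> (cmod (\<Sum>a\<in>\<Omega>. w a * circ (lin \<phi> (x a))))\<^sup>2" by blast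
    have P_eq: "(\<Sum>a\<in>\<Omega>. w a * circ (lin \<phi> (x a))) = P \<phi>"
    proof -
      have "(1 + circ (lin \<phi> (v j) - t j)) ^ N =
          (\<Sum>k\<le>N. of_nat (N choose k) * circ (- (real k * t j)) * circ (real k * lin \<phi> (v j)))" for j
      proof -
        have "circ (lin \<phi> (v j) - t j) ^ k = circ (- (real k * t j)) * circ (real k * lin \<phi> (v j))" for k
          by (simp only: circ_add[symmetric] Complex.DeMoivre) (simp add: algebra_simps)
        then show ?thesis
          by (subst add.commute, subst binomial_ring) (simp add: mult_ac)
      qed
      then have "P \<phi> = (\<Prod>j\<in>J. \<Sum>k\<le>N. of_nat (N choose k) * circ (- (real k * t j)) * circ (real k * lin \<phi> (v j)))"
        by (simp add: P_def)
      also have "\<dots> = (\<Sum>a\<in>\<Omega>. \<Prod>j\<in>J. of_nat (N choose a j) * circ (- (real (a j) * t j)) * circ (real (a j) * lin \<phi> (v j)))"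
        unfolding \<Omega>_def by (rule prod_sum_PiE) (use J in auto)
      also have "\<dots> = (\<Sum>a\<in>\<Omega>. w a * circ (lin \<phi> (x a)))"
        by (simp only: w_def x_def lin_sum lin_cmul circ_sum prod.distrib of_int_of_nat_eq)
      finally show ?thesis ..
    qed
    have "(\<Sum>a\<in>\<Omega>. cmod (w a)) = (2 ^ N) ^ card J"
    proof -
      have "(\<Sum>a\<in>\<Omega>. cmod (w a)) = (\<Sum>a\<in>\<Omega>. \<Prod>j\<in>J. real (N choose a j))"
        by (simp add: w_def norm_mult prod_norm[symmetric])
      also have "\<dots> = (\<Prod>j\<in>J. \<Sum>k\<le>N. real (N choose k))"
        unfolding \<Omega>_def by (rule prod_sum_PiE[symmetric]) (use J in auto)
      also have "(\<Sum>k\<le>N. real (N choose k)) = 2 ^ N"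
        by (metis choose_row_sum of_nat_numeral of_nat_power of_nat_sum)
      finally show ?thesis by simp
    qed
    then have "((2 ^ N) ^ card J)\<^sup>2 \<le> (\<Sum>a\<in>\<Omega>. (cmod (w a))\<^sup>2) * real (card \<Omega>)"
      using sum_squared_le_sum_of_squares[of "\<lambda>a. cmod (w a)" \<Omega>] by simp
    also have "\<dots> \<le> (cmod (P \<phi>))\<^sup>2 * real (Suc N) ^ card J"
      using \<phi> by (simp only: P_eq \<Omega>(2) of_nat_power) (intro mult_right_mono, auto)
    also have "\<dots> \<le> ((4 ^ N) ^ card J * \<kappa> ^ N) * real (Suc N) ^ card J"
    proof (rule mult_right_mono)
      obtain j where j: "j \<in> J" and "\<And>p::int. \<delta> \<le> \<bar>lin \<phi> (v j) - t j - of_int p\<bar>"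
        using no by (meson not_less)
      from far[OF this(2)] have j_far: "((cmod (1 + circ (lin \<phi> (v j) - t j)))\<^sup>2) ^ N \<le> (4 * \<kappa>) ^ N"
        by (intro power_mono) auto
      have bound: "((cmod (1 + circ s))\<^sup>2) ^ N \<le> 4 ^ N" for s
      proof -
        have "cmod (1 + circ s) \<le> 2" using norm_triangle_ineq[of 1 "circ s"] by simp
        then have "(cmod (1 + circ s))\<^sup>2 \<le> 2\<^sup>2" by (intro power_mono) auto
        then show ?thesis by (intro power_mono) auto
      qed
      have "(cmod (P \<phi>))\<^sup>2 = (\<Prod>i\<in>J. ((cmod (1 + circ (lin \<phi> (v i) - t i)))\<^sup>2) ^ N)"
        by (simp add: P_def prod_norm[symmetric] norm_power prod_power_distrib power_mult[symmetric] mult.commute)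
      also have "\<dots> = ((cmod (1 + circ (lin \<phi> (v j) - t j)))\<^sup>2) ^ N *
          (\<Prod>i\<in>J - {j}. ((cmod (1 + circ (lin \<phi> (v i) - t i)))\<^sup>2) ^ N)"
        by (rule prod.remove[OF J j])
      also have "\<dots> \<le> (4 * \<kappa>) ^ N * (\<Prod>i\<in>J - {j}. 4 ^ N)"
        using j_far bound \<kappa> by (intro mult_mono prod_mono prod_nonneg) auto
      also have "\<dots> = (4 ^ N) ^ card J * \<kappa> ^ N"
      proof -
        have "card J = Suc (card (J - {j}))" using card_Suc_Diff1[OF J j] by simp
        then show ?thesis by (simp add: power_mult_distrib)
      qed
      finally show "(cmod (P \<phi>))\<^sup>2 \<le> (4 ^ N) ^ card J * \<kappa> ^ N" .
    qed simp
    also have "\<dots> = (4 ^ N) ^ card J * (real (Suc N) ^ card J * \<kappa> ^ N)" by simp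
    also have "\<dots> < (4 ^ N) ^ card J"
      using N by simp
    also have "\<dots> = ((2 ^ N) ^ card J)\<^sup>2"
      by (simp add: power_mult[symmetric] mult.commute) (simp add: power_mult)
    finally show False by simp
  qed
  note approximable = this
  show ?thesis
    by (intro exI[of _ N] allI impI, rule approximable) simp
qed

section \<open>Counting below the continuum\<close>

lemma sequences_lepoll_Pow_nat:
  assumes "X \<lesssim> (UNIV :: nat set set)"
  shows "{p :: nat \<Rightarrow> 'a. range p \<subseteq> X} \<lesssim> (UNIV :: nat set set)"
proof -
  obtain b :: "'a \<Rightarrow> nat set" where b: "inj_on b X"
    using assms by (auto simp: lepoll_def)
  define code where "code p = {prod_encode (n, m) |n m. m \<in> b (p n)}" for p :: "nat \<Rightarrow> 'a"
  have "inj_on code {p. range p \<subseteq> X}"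
  proof (rule inj_onI)
    fix p q assume p: "p \<in> {p. range p \<subseteq> X}" and q: "q \<in> {p. range p \<subseteq> X}" and "code p = code q"
    have mem: "prod_encode (n, m) \<in> code p \<longleftrightarrow> m \<in> b (p n)" for p n m
      by (auto simp: code_def)
    have "b (p n) = b (q n)" for n
      using mem[of n _ p] mem[of n _ q] \<open>code p = code q\<close> by blast
    moreover have "p n \<in> X" "q n \<in> X" for n using p q by auto
    ultimately show "p = q" using inj_onD[OF b] by blast
  qed
  then show ?thesis by (auto simp: lepoll_def)
qed

text \<open>This is Koenig's diagonal argument, which shows that the continuum has uncountable cofinality: if no \<open>Y n\<close>
has the size of the continuum, then for a given family of sequences indexed by the union, some \<open>p n\<close>
differs from the \<open>n\<close>-th terms of all sequences with index in \<open>Y n\<close>.\<close>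

lemma continuum_not_countable_union:
  fixes Y :: "nat \<Rightarrow> 'a set"
  assumes "(UNIV :: nat set set) \<lesssim> (\<Union>n. Y n)"
  shows "\<exists>n. (UNIV :: nat set set) \<lesssim> Y n"
proof (rule ccontr)
  assume no: "\<not> ?thesis"
  have "(UNIV :: (nat \<Rightarrow> nat set) set) \<lesssim> (UNIV :: nat set set)"
    using sequences_lepoll_Pow_nat[OF lepoll_refl] by simp
  also have "\<dots> \<lesssim> (\<Union>n. Y n)" by (rule assms)
  finally obtain k :: "'a \<Rightarrow> nat \<Rightarrow> nat set" where k: "UNIV \<subseteq> k ` (\<Union>n. Y n)"
    unfolding lepoll_iff by blast
  have "\<exists>p. p \<notin> (\<lambda>y. k y n) ` Y n" for n
    using no unfolding lepoll_iff by blast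
  then obtain p where p: "\<And>n. p n \<notin> (\<lambda>y. k y n) ` Y n" by metis
  obtain y n where "y \<in> Y n" "p = k y" using k by blast
  with p[of n] show False by auto
qed

text \<open>The nodes of the binary tree along the branch \<open>x\<close>, coded injectively as numbers.  Adjoining \<open>n\<close> to the
initial segment records its length, so that distinct branches are almost disjoint.\<close>

definition branch_code :: "nat set \<Rightarrow> nat \<Rightarrow> nat" where
  "branch_code x n = set_encode (insert n (x \<inter> {..<n}))"

lemma branch_code_eq:
  assumes "branch_code x n = branch_code y m"
  shows "n = m" "x \<inter> {..<n} = y \<inter> {..<m}"
proof -
  have eq: "insert n (x \<inter> {..<n}) = insert m (y \<inter> {..<m})"
    using assms unfolding branch_code_def by (subst (asm) set_encode_eq) auto
  then have "n \<le> m" "m \<le> n" by (auto simp: set_eq_iff)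
  then show "n = m" by simp
  with eq show "x \<inter> {..<n} = y \<inter> {..<m}" by (auto simp: set_eq_iff)
qed

lemma inj_branch_code: "inj (branch_code x)"
  using branch_code_eq(1) by (auto simp: inj_def)

lemma branch_code_eventually_neq:
  assumes "free_ultrafilter U" "x \<noteq> y"
  shows "\<forall>\<^sub>F n in U. branch_code x n \<noteq> branch_code y n"
proof -
  obtain i where i: "i \<in> x \<longleftrightarrow> i \<notin> y" using \<open>x \<noteq> y\<close> by blast
  from free_ultrafilter_eventually_notin_finite[OF assms(1) finite_atMost[of i]]
  show ?thesis
    by (rule eventually_mono) (use i branch_code_eq(2) in fastforce)
qed

text \<open>The set \<open>A\<close> is enlarged by a countable infinite subset of \<open>C\<close>, which keeps it smaller than the
continuum; then the free Abelian group on it has the same size, and a union of as many countable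
sets cannot reach the continuum.\<close>

lemma small_family_countable_fibres:
  fixes C :: "'c set" and A :: "'c set" and h :: "nat set \<Rightarrow> int \<times> ('c \<Rightarrow>\<^sub>0 int)"
  assumes C: "C \<approx> (UNIV :: nat set set)" and A: "A \<subseteq> C" "\<not> C \<lesssim> A"
    and h: "\<And>x. Poly_Mapping.keys (snd (h x)) \<subseteq> A"
  shows "\<exists>i. uncountable (h -` {i})"
proof (rule ccontr)
  assume no: "\<not> ?thesis"
  have "uncountable (UNIV :: nat set set)"
    using uncountable_UNIV_real nat_sets_eqpoll_reals countable_eqpoll eqpoll_sym by blast
  then have unc: "uncountable C" using C countable_eqpoll eqpoll_sym by blast
  then have "infinite C" using countable_finite by blast
  then obtain Z where Z: "Z \<subseteq> C" "infinite Z" "countable Z" by (meson infinite_countable_subset')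
  define B where "B = A \<union> Z"
  have "infinite B" using Z by (simp add: B_def)
  have "|Z| <o |C|"
  proof -
    have "\<not> C \<lesssim> Z" using unc Z(3) countable_lepoll by blast
    then show ?thesis by (simp add: lepoll_def card_of_ordLeq not_ordLeq_iff_ordLess)
  qed
  moreover have "|A| <o |C|" using A(2) by (simp add: lepoll_def card_of_ordLeq not_ordLeq_iff_ordLess)
  ultimately have B: "|B| <o |C|" unfolding B_def using \<open>infinite C\<close> by (simp add: card_of_Un_ordLess_infinite)
  have "|carrier (free_Abelian_group B)| \<le>o |B|"
    using eqpoll_free_Abelian_group_infinite[OF \<open>infinite B\<close>] by (simp add: eqpoll_iff_card_of_ordIso ordIso_iff_ordLeq)
  moreover have "|UNIV :: int set| \<le>o |B|"
    using \<open>infinite B\<close> by (simp flip: infinite_iff_card_of_countable)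
  ultimately have I: "|(UNIV :: int set) \<times> carrier (free_Abelian_group B)| \<le>o |B|"
    using \<open>infinite B\<close> by (simp add: card_of_Times_ordLeq_infinite)
  have fib: "|h -` {i}| \<le>o |B|" for i
  proof -
    have "countable (h -` {i})" using no by blast
    then show ?thesis
      using \<open>infinite B\<close> by (metis countable_def card_of_ordLeq infinite_iff_card_of_nat ordLeq_transitive subset_UNIV)
  qed
  have whole: "|UNIV :: nat set set| \<le>o |\<Union>i\<in>(UNIV :: int set) \<times> carrier (free_Abelian_group B). h -` {i}|"
  proof (rule card_of_mono1)
    show "UNIV \<subseteq> (\<Union>i\<in>(UNIV :: int set) \<times> carrier (free_Abelian_group B). h -` {i})"
    proof
      fix x
      have "h x \<in> UNIV \<times> carrier (free_Abelian_group B)"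
        using h[of x] by (auto simp: B_def mem_Times_iff)
      then show "x \<in> (\<Union>i\<in>(UNIV :: int set) \<times> carrier (free_Abelian_group B). h -` {i})" by blast
    qed
  qed
  have "|\<Union>i\<in>(UNIV :: int set) \<times> carrier (free_Abelian_group B). h -` {i}| \<le>o |B|"
    using \<open>infinite B\<close> I fib by (intro card_of_UNION_ordLeq_infinite) auto
  with whole have "|UNIV :: nat set set| \<le>o |B|" by (rule ordLeq_transitive)
  moreover have "|C| \<le>o |UNIV :: nat set set|" using C by (simp add: eqpoll_iff_card_of_ordIso ordIso_iff_ordLeq)
  ultimately have "|C| \<le>o |B|" by (rule ordLeq_transitive[rotated])
  with B show False by (simp add: not_ordLess_ordLeq)
qed

text \<open>Here \<open>F n r\<close> stands for the \<open>n\<close>-th term of the combination, with coefficients \<open>r\<close>, of the sequences chosen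
earlier.  If all the subsequences along branches \<open>x\<close> depended on these, each would satisfy a relation
with coefficients \<open>(m, r)\<close> and a constant term \<open>s\<close>.  There are too few pairs \<open>(m, r)\<close>, so uncountably many
branches share one.  For these, \<open>s\<close> determines the branch, since \<open>G\<close> is torsion-free and distinct branches
are eventually distinct; but up to a shift \<open>s\<close> lies in the countable set of the differences of
multiples of terms of \<open>g\<close>.  This is a contradiction.\<close>

lemma exists_independent_subsequence:
  fixes C :: "'c set" and g :: "nat \<Rightarrow> ('c \<Rightarrow>\<^sub>0 int)" and F :: "nat \<Rightarrow> ('c \<Rightarrow>\<^sub>0 int) \<Rightarrow> ('c \<Rightarrow>\<^sub>0 int)"
  assumes U: "free_ultrafilter U" and C: "C \<approx> (UNIV :: nat set set)" and A: "A \<subseteq> C" "\<not> C \<lesssim> A"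
    and g: "inj g"
  shows "\<exists>j :: nat \<Rightarrow> nat. inj j \<and> (\<forall>m r s. m \<noteq> 0 \<longrightarrow> Poly_Mapping.keys r \<subseteq> A \<longrightarrow>
    (\<forall>\<^sub>F n in U. frag_cmul m (g (j n)) \<noteq> F n r + s))"
proof (rule ccontr)
  assume no: "\<not> ?thesis"
  have ultra: "ultrafilter U" using U by (simp add: free_ultrafilter_def)
  have "\<exists>m r s. m \<noteq> 0 \<and> Poly_Mapping.keys r \<subseteq> A \<and>
      (\<forall>\<^sub>F n in U. frag_cmul m (g (branch_code x n)) = F n r + s)" for x
  proof -
    obtain m r s where mr: "m \<noteq> 0" "Poly_Mapping.keys r \<subseteq> A"
      and "\<not> (\<forall>\<^sub>F n in U. frag_cmul m (g (branch_code x n)) \<noteq> F n r + s)"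
      using no inj_branch_code[of x] by blast
    then have "\<forall>\<^sub>F n in U. frag_cmul m (g (branch_code x n)) = F n r + s"
      using ultrafilter_eventually_iff[OF ultra, of "{n. frag_cmul m (g (branch_code x n)) = F n r + s}"] by simp
    with mr show ?thesis by blast
  qed
  then have "\<forall>x. \<exists>m r s. m \<noteq> 0 \<and> Poly_Mapping.keys r \<subseteq> A \<and>
      (\<forall>\<^sub>F n in U. frag_cmul m (g (branch_code x n)) = F n r + s)" ..
  from choice[OF this] obtain m where "\<forall>x. \<exists>r s. m x \<noteq> 0 \<and> Poly_Mapping.keys r \<subseteq> A \<and>
      (\<forall>\<^sub>F n in U. frag_cmul (m x) (g (branch_code x n)) = F n r + s)" ..
  from choice[OF this] obtain r where "\<forall>x. \<exists>s. m x \<noteq> 0 \<and> Poly_Mapping.keys (r x) \<subseteq> A \<and>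
      (\<forall>\<^sub>F n in U. frag_cmul (m x) (g (branch_code x n)) = F n (r x) + s)" ..
  from choice[OF this] obtain s where m: "\<And>x. m x \<noteq> 0" and r: "\<And>x. Poly_Mapping.keys (r x) \<subseteq> A"
    and rel: "\<And>x. \<forall>\<^sub>F n in U. frag_cmul (m x) (g (branch_code x n)) = F n (r x) + s x"
    by blast
  obtain i where i: "uncountable ((\<lambda>x. (m x, r x)) -` {i})"
    using small_family_countable_fibres[OF C A, of "\<lambda>x. (m x, r x)"] r by auto
  let ?X = "(\<lambda>x. (m x, r x)) -` {i}"
  obtain x0 where x0: "x0 \<in> ?X" using i by (metis countable_empty ex_in_conv)
  have eq: "m x = fst i" "r x = snd i" if "x \<in> ?X" for x using that by auto
  have "inj_on (\<lambda>x. s x - s x0) ?X"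
  proof (rule inj_onI, rule ccontr)
    fix x y assume xy: "x \<in> ?X" "y \<in> ?X" "s x - s x0 = s y - s x0" "x \<noteq> y"
    from branch_code_eventually_neq[OF U \<open>x \<noteq> y\<close>] rel[of x] rel[of y]
    have "\<forall>\<^sub>F n in U. False"
    proof eventually_elim
      case (elim n)
      have "frag_cmul (fst i) (g (branch_code x n)) = frag_cmul (fst i) (g (branch_code y n))"
        using elim(2,3) eq[OF xy(1)] eq[OF xy(2)] xy(3) by simp
      then have "frag_cmul (fst i) (g (branch_code x n) - g (branch_code y n)) = 0"
        by (simp add: poly_mapping_eq_iff fun_eq_iff lookup_minus)
      moreover have "fst i \<noteq> 0" using m[of x] eq[OF xy(1)] by simp
      ultimately have "g (branch_code x n) = g (branch_code y n)" by simp
      with g elim(1) show False by (simp add: inj_eq)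
    qed
    then show False using ultra by (simp add: ultrafilter_def)
  qed
  note inj = this
  have "(\<lambda>x. s x - s x0) ` ?X \<subseteq> range (\<lambda>(a, b). frag_cmul (fst i) (g a) - frag_cmul (fst i) (g b))"
  proof
    fix d assume "d \<in> (\<lambda>x. s x - s x0) ` ?X"
    then obtain x where x: "x \<in> ?X" "d = s x - s x0" by blast
    from rel[of x] rel[of x0]
    have "\<forall>\<^sub>F n in U. d = frag_cmul (fst i) (g (branch_code x n)) - frag_cmul (fst i) (g (branch_code x0 n))"
      by eventually_elim (use x eq[OF x(1)] eq[OF x0] in simp)
    moreover have "U \<noteq> bot" using ultra by (simp add: ultrafilter_def)
    ultimately obtain n where "d = frag_cmul (fst i) (g (branch_code x n)) - frag_cmul (fst i) (g (branch_code x0 n))"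
      using eventually_happens by blast
    then show "d \<in> range (\<lambda>(a, b). frag_cmul (fst i) (g a) - frag_cmul (fst i) (g b))" by auto
  qed
  then have "countable ((\<lambda>x. s x - s x0) ` ?X)" by (rule countable_subset) simp
  then have "countable ?X" using inj by (rule countable_image_inj_on)
  with i show False ..
qed

text \<open>In the bookkeeping function \<open>h\<close> every injective sequence \<open>g\<close> is attached to continuum many generators.  As
the support of \<open>g\<close> is countable and initial segments of \<open>C\<close> are small, one of these generators lies above the whole
support, by \<open>continuum_not_countable_union\<close>.  A relation among the sequences
chosen recursively is excluded by looking at the largest generator that occurs in it.\<close>

lemma exists_independent_family:
  fixes C :: "'c set"
  assumes U: "free_ultrafilter U" and C: "C \<approx> (UNIV :: nat set set)"
  obtains R :: "('c \<times> 'c) set" and I f where "wf R" "I \<subseteq> C"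
    "\<And>\<xi> n \<eta>. \<xi> \<in> I \<Longrightarrow> \<eta> \<in> Poly_Mapping.keys (f \<xi> n) \<Longrightarrow> (\<eta>, \<xi>) \<in> R"
    "\<And>r s. Poly_Mapping.keys r \<subseteq> I \<Longrightarrow> r \<noteq> 0 \<Longrightarrow> \<forall>\<^sub>F n in U. frag_extend (\<lambda>\<xi>. f \<xi> n) r \<noteq> s"
    "\<And>g. inj g \<Longrightarrow> (\<And>n. Poly_Mapping.keys (g n) \<subseteq> C) \<Longrightarrow>
      \<exists>\<xi>\<in>I. \<exists>j :: nat \<Rightarrow> nat. inj j \<and> f \<xi> = g \<circ> j"
proof -
  have "uncountable (UNIV :: nat set set)"
    using uncountable_UNIV_real nat_sets_eqpoll_reals countable_eqpoll eqpoll_sym by blast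
  then have "uncountable C" using C countable_eqpoll eqpoll_sym by blast
  then have inf: "infinite C" using countable_finite by blast
  define W where "W = card_of C"
  have W: "Card_order W" "Field W = C" by (simp_all add: W_def Field_card_of)
  have wo: "Well_order W" unfolding W_def by (rule card_of_Well_order)
  then have tot: "total_on C W" and tr: "trans W" and wfW: "wf (W - Id)" and refl: "refl_on C W"
    unfolding W(2) order_on_defs by blast+
  have W_C: "W \<subseteq> C \<times> C" using W(2) by (auto simp: Field_def)
  have small_underS: "\<not> C \<lesssim> underS W \<xi>" if "\<xi> \<in> C" for \<xi>
    using card_of_underS[OF W(1), of \<xi>] that W(2)
    by (simp add: W_def lepoll_def card_of_ordLeq not_ordLeq_iff_ordLess)
  have small_under: "\<not> C \<lesssim> under W \<xi>" for \<xi>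
  proof (cases "\<xi> \<in> C")
    case True
    have "under W \<xi> \<subseteq> insert \<xi> (underS W \<xi>)" by (auto simp: under_def underS_def)
    moreover have "\<not> C \<lesssim> insert \<xi> (underS W \<xi>)"
    proof (cases "finite (underS W \<xi>)")
      case True
      then show ?thesis using inf by (metis finite_insert lepoll_def finite_imageD finite_subset)
    next
      case False
      show ?thesis
        using small_underS[OF \<open>\<xi> \<in> C\<close>] lepoll_trans2[OF _ infinite_insert_eqpoll[OF False]] by metis
    qed
    ultimately show ?thesis using subset_imp_lepoll lepoll_trans by blast
  next
    case False
    then have "under W \<xi> = {}" using W_C by (auto simp: under_def)
    with inf show ?thesis by auto
  qed
  define \<G> where "\<G> = {g :: nat \<Rightarrow> ('c \<Rightarrow>\<^sub>0 int). inj g \<and> (\<forall>n. Poly_Mapping.keys (g n) \<subseteq> C)}"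
  have "carrier (free_Abelian_group C) \<lesssim> (UNIV :: nat set set)"
    using eqpoll_free_Abelian_group_infinite[OF inf] C by (meson eqpoll_imp_lepoll eqpoll_trans)
  from sequences_lepoll_Pow_nat[OF this] have "\<G> \<lesssim> (UNIV :: nat set set)"
    by (rule lepoll_trans[OF subset_imp_lepoll, rotated]) (auto simp: \<G>_def)
  also have "\<dots> \<lesssim> C" using C by (meson eqpoll_imp_lepoll eqpoll_sym)
  finally have "|\<G>| \<le>o |C|" by (simp add: lepoll_def card_of_ordLeq)
  then have "|\<G> \<times> C| \<le>o |C|" using inf by (simp add: card_of_Times_ordLeq_infinite)
  then have "\<G> \<times> C \<lesssim> C" by (simp add: lepoll_def card_of_ordLeq)
  then obtain h where h: "\<G> \<times> C \<subseteq> h ` C" unfolding lepoll_iff by blast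
  define H where "H = fst \<circ> h"
  define I where "I = {\<xi>\<in>C. inj (H \<xi>) \<and> (\<forall>n. Poly_Mapping.keys (H \<xi> n) \<subseteq> underS W \<xi>)}"
  have cover: "\<exists>\<xi>\<in>I. H \<xi> = g" if g: "g \<in> \<G>" for g
  proof -
    define K where "K = (\<Union>n. Poly_Mapping.keys (g n))"
    have "countable K" by (auto simp: K_def countable_finite)
    let ?Y = "\<lambda>n. under W (from_nat_into K n)"
    have "\<not> {\<xi>\<in>C. H \<xi> = g} \<subseteq> (\<Union>n. ?Y n)"
    proof
      assume sub: "{\<xi>\<in>C. H \<xi> = g} \<subseteq> (\<Union>n. ?Y n)"
      have "C \<subseteq> (snd \<circ> h) ` {\<xi>\<in>C. H \<xi> = g}"
      proof
        fix c assume "c \<in> C"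
        then have "(g, c) \<in> h ` C" using g h by blast
        then obtain \<xi> where \<xi>: "\<xi> \<in> C" "(g, c) = h \<xi>" by blast
        have "c = (snd \<circ> h) \<xi>" "H \<xi> = g" using \<xi>(2)[symmetric] by (simp_all add: H_def)
        with \<xi>(1) show "c \<in> (snd \<circ> h) ` {\<xi>\<in>C. H \<xi> = g}" by blast
      qed
      then have "C \<lesssim> {\<xi>\<in>C. H \<xi> = g}" unfolding lepoll_iff by blast
      then have "C \<lesssim> (\<Union>n. ?Y n)" using sub by (meson lepoll_trans subset_imp_lepoll)
      then have "\<exists>n. (UNIV :: nat set set) \<lesssim> ?Y n"
        by (intro continuum_not_countable_union) (meson C eqpoll_sym lepoll_trans1)
      then show False using small_under C by (meson lepoll_trans1)
    qed
    then obtain \<xi> where \<xi>: "\<xi> \<in> C" "H \<xi> = g" and "\<And>n. \<xi> \<notin> ?Y n" by blast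
    then have far: "(\<xi>, a) \<notin> W" if "a \<in> K" for a
      using that subset_range_from_nat_into[OF \<open>countable K\<close>] by (auto simp: under_def)
    have "Poly_Mapping.keys (g n) \<subseteq> underS W \<xi>" for n
    proof
      fix a assume a: "a \<in> Poly_Mapping.keys (g n)"
      then have "a \<in> C" "(\<xi>, a) \<notin> W" using g far by (auto simp: \<G>_def K_def)
      moreover have "(\<xi>, \<xi>) \<in> W" using refl \<xi>(1) by (rule refl_onD)
      ultimately show "a \<in> underS W \<xi>" using tot \<xi>(1) by (auto simp: underS_def total_on_def)
    qed
    then have "\<xi> \<in> I" using \<xi> g by (auto simp: I_def \<G>_def)
    with \<xi>(2) show ?thesis by blast
  qed
  define P where "P f \<xi> f\<xi> \<longleftrightarrow> (\<xi> \<in> I \<longrightarrow> (\<exists>j :: nat \<Rightarrow> nat. inj j \<and> f\<xi> = H \<xi> \<circ> j) \<and>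
    (\<forall>m r s. m \<noteq> 0 \<longrightarrow> Poly_Mapping.keys r \<subseteq> underS W \<xi> \<longrightarrow>
      (\<forall>\<^sub>F n in U. frag_cmul m (f\<xi> n) \<noteq> frag_extend (\<lambda>\<eta>. f \<eta> n) r + s)))"
    for f :: "'c \<Rightarrow> nat \<Rightarrow> ('c \<Rightarrow>\<^sub>0 int)" and \<xi> f\<xi>
  have "\<exists>f. \<forall>\<xi>. P f \<xi> (f \<xi>)"
  proof (rule dependent_wf_choice[OF wfW])
    fix f f' :: "'c \<Rightarrow> nat \<Rightarrow> ('c \<Rightarrow>\<^sub>0 int)" and \<xi> f\<xi>
    assume eq: "\<And>\<eta>. (\<eta>, \<xi>) \<in> W - Id \<Longrightarrow> f \<eta> = f' \<eta>"
    have "frag_extend (\<lambda>\<eta>. f \<eta> n) r = frag_extend (\<lambda>\<eta>. f' \<eta> n) r"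
      if "Poly_Mapping.keys r \<subseteq> underS W \<xi>" for n r
      using that eq by (intro frag_extend_eq) (auto simp: underS_def)
    then show "P f \<xi> f\<xi> = P f' \<xi> f\<xi>" unfolding P_def by (simp cong: imp_cong)
  next
    fix \<xi> and f :: "'c \<Rightarrow> nat \<Rightarrow> ('c \<Rightarrow>\<^sub>0 int)"
    show "\<exists>f\<xi>. P f \<xi> f\<xi>"
    proof (cases "\<xi> \<in> I")
      case True
      then have \<xi>: "\<xi> \<in> C" "inj (H \<xi>)" by (auto simp: I_def)
      have "underS W \<xi> \<subseteq> C" using W_C by (auto simp: underS_def)
      from exists_independent_subsequence[OF U C this small_underS[OF \<xi>(1)] \<xi>(2),
          of "\<lambda>n. frag_extend (\<lambda>\<eta>. f \<eta> n)"]
      obtain j :: "nat \<Rightarrow> nat" where "inj j" "\<forall>m r s. m \<noteq> 0 \<longrightarrow> Poly_Mapping.keys r \<subseteq> underS W \<xi> \<longrightarrow>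
          (\<forall>\<^sub>F n in U. frag_cmul m (H \<xi> (j n)) \<noteq> frag_extend (\<lambda>\<eta>. f \<eta> n) r + s)" by blast
      then show ?thesis by (intro exI[of _ "H \<xi> \<circ> j"]) (auto simp: P_def)
    qed (simp add: P_def)
  qed
  then obtain f where f: "\<And>\<xi>. P f \<xi> (f \<xi>)" by blast
  show thesis
  proof
    show "wf (W - Id)" by (rule wfW)
    show "I \<subseteq> C" by (auto simp: I_def)
    show "(\<eta>, \<xi>) \<in> W - Id" if \<xi>: "\<xi> \<in> I" and \<eta>: "\<eta> \<in> Poly_Mapping.keys (f \<xi> n)" for \<xi> n \<eta>
    proof -
      obtain j where "f \<xi> = H \<xi> \<circ> j" using f[of \<xi>] \<xi> by (auto simp: P_def)
      with \<xi> \<eta> show ?thesis by (auto simp: I_def underS_def)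
    qed
    show "\<exists>\<xi>\<in>I. \<exists>j :: nat \<Rightarrow> nat. inj j \<and> f \<xi> = g \<circ> j"
      if g: "inj g" "\<And>n. Poly_Mapping.keys (g n) \<subseteq> C" for g
    proof -
      obtain \<xi> where "\<xi> \<in> I" "H \<xi> = g" using cover[of g] g by (auto simp: \<G>_def)
      with f[of \<xi>] show ?thesis by (auto simp: P_def)
    qed
    show "\<forall>\<^sub>F n in U. frag_extend (\<lambda>\<xi>. f \<xi> n) r \<noteq> s"
      if r: "Poly_Mapping.keys r \<subseteq> I" "r \<noteq> 0" for r s
    proof -
      have max: "\<exists>\<xi>\<in>K. \<forall>\<eta>\<in>K. \<eta> \<noteq> \<xi> \<longrightarrow> (\<eta>, \<xi>) \<in> W" if "finite K" "K \<noteq> {}" "K \<subseteq> C" for K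
        using that
      proof (induction K rule: finite_ne_induct)
        case (insert a K)
        then obtain \<xi> where \<xi>: "\<xi> \<in> K" "\<forall>\<eta>\<in>K. \<eta> \<noteq> \<xi> \<longrightarrow> (\<eta>, \<xi>) \<in> W" by auto
        with insert have "(a, \<xi>) \<in> W \<or> (\<xi>, a) \<in> W" using tot by (auto simp: total_on_def)
        then show ?case
        proof
          assume "(\<xi>, a) \<in> W"
          then have "\<forall>\<eta>\<in>K. (\<eta>, a) \<in> W" using \<xi> tr by (metis transE)
          then show ?thesis by auto
        qed (use \<xi> in auto)
      qed simp
      have "Poly_Mapping.keys r \<noteq> {}" "Poly_Mapping.keys r \<subseteq> C" using r by (auto simp: I_def)
      from max[OF finite_keys this] obtain \<xi> where \<xi>: "\<xi> \<in> Poly_Mapping.keys r"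
        and top: "\<And>\<eta>. \<eta> \<in> Poly_Mapping.keys r \<Longrightarrow> \<eta> \<noteq> \<xi> \<Longrightarrow> (\<eta>, \<xi>) \<in> W"
        by blast
      define m where "m = Poly_Mapping.lookup r \<xi>"
      define r' where "r' = frag_cmul m (frag_of \<xi>) - r"
      have "m \<noteq> 0" using \<xi> by (simp add: m_def in_keys_iff)
      moreover have "Poly_Mapping.keys r' \<subseteq> underS W \<xi>"
      proof
        fix \<eta> assume "\<eta> \<in> Poly_Mapping.keys r'"
        then have "\<eta> \<noteq> \<xi>" "\<eta> \<in> Poly_Mapping.keys r"
          by (auto simp: r'_def in_keys_iff lookup_minus m_def split: if_splits)
        with top show "\<eta> \<in> underS W \<xi>" by (auto simp: underS_def)
      qed
      moreover have "\<xi> \<in> I" using \<xi> r(1) by blast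
      ultimately have "\<forall>\<^sub>F n in U. frag_cmul m (f \<xi> n) \<noteq> frag_extend (\<lambda>\<eta>. f \<eta> n) r' + s"
        using f[of \<xi>] by (simp add: P_def)
      then show ?thesis
        by eventually_elim (auto simp: r'_def frag_extend_diff frag_extend_cmul)
    qed
  qed
qed

section \<open>Characters compatible with prescribed limits\<close>

definition compatible :: "nat filter \<Rightarrow> 'c set \<Rightarrow> ('c \<Rightarrow> nat \<Rightarrow> ('c \<Rightarrow>\<^sub>0 int)) \<Rightarrow> ('c \<Rightarrow> real) set" where
  "compatible U I f = {\<phi>. \<forall>\<xi>\<in>I. ((\<lambda>n. circ (lin \<phi> (f \<xi> n))) \<longlongrightarrow> circ (\<phi> \<xi>)) U}"

lemma lookup_sum_frag_cmul_frag_of: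
  assumes "finite S"
  shows "Poly_Mapping.lookup (\<Sum>c\<in>S. frag_cmul (m c) (frag_of c)) d = (if d \<in> S then m d else 0)"
  using assms by (induction S rule: finite_induct) (auto simp: lookup_add)

text \<open>The intervals with centre \<open>x i\<close> and radius \<open>2 * e i\<close> are nested.\<close>

lemma geometric_steps_limit:
  fixes x e :: "nat \<Rightarrow> real"
  assumes step: "\<And>i. i \<ge> k \<Longrightarrow> \<bar>x (Suc i) - x i\<bar> \<le> e i"
    and half: "\<And>i. e (Suc i) \<le> e i / 2" and nonneg: "\<And>i. 0 \<le> e i"
  shows "\<exists>l. \<forall>i\<ge>k. \<bar>l - x i\<bar> \<le> 2 * e i"
proof -
  define lo where "lo i = x (k + i) - 2 * e (k + i)" for i
  define hi where "hi i = x (k + i) + 2 * e (k + i)" for i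
  have "lo i \<le> lo (Suc i)" "hi (Suc i) \<le> hi i" for i
    using step[of "k + i"] half[of "k + i"] by (auto simp: lo_def hi_def)
  then have mono: "mono lo" "antimono hi"
    by (auto intro: mono_iff_le_Suc[THEN iffD2] antimono_iff_le_Suc[THEN iffD2])
  have le: "lo i \<le> hi j" for i j
  proof -
    have "lo i \<le> lo (max i j)" using mono(1) by (simp add: monoD)
    also have "\<dots> \<le> hi (max i j)" using nonneg[of "k + max i j"] by (simp add: lo_def hi_def)
    also have "\<dots> \<le> hi j" using mono(2) by (simp add: antimonoD)
    finally show ?thesis .
  qed
  have bdd: "bdd_above (range lo)" using le[of _ 0] by (auto intro!: bdd_aboveI2)
  have "\<bar>(SUP i. lo i) - x i\<bar> \<le> 2 * e i" if "k \<le> i" for i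
  proof -
    have "lo (i - k) \<le> (SUP i. lo i)" by (rule cSUP_upper[OF _ bdd]) simp
    moreover have "(SUP i. lo i) \<le> hi (i - k)" using le by (intro cSUP_least) auto
    ultimately show ?thesis using that by (simp add: lo_def hi_def abs_le_iff)
  qed
  then show ?thesis by blast
qed

text \<open>The last assumption says that in the ultrapower modulo \<open>U\<close> the classes of the sequences \<open>f \<xi>\<close> are linearly
independent modulo the constant sequences.\<close>

locale independent_sequences =
  fixes U :: "nat filter" and R :: "('c \<times> 'c) set" and I :: "'c set"
    and f :: "'c \<Rightarrow> nat \<Rightarrow> ('c \<Rightarrow>\<^sub>0 int)"
  assumes sel: "selective_ultrafilter U"
    and wf: "wf R"
    and keys_f: "\<And>\<xi> n \<eta>. \<xi> \<in> I \<Longrightarrow> \<eta> \<in> Poly_Mapping.keys (f \<xi> n) \<Longrightarrow> (\<eta>, \<xi>) \<in> R"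
    and indep: "\<And>r s. Poly_Mapping.keys r \<subseteq> I \<Longrightarrow> r \<noteq> 0 \<Longrightarrow>
      \<forall>\<^sub>F n in U. frag_extend (\<lambda>\<xi>. f \<xi> n) r \<noteq> s"
begin

lemma free: "free_ultrafilter U"
  using sel by (simp add: selective_ultrafilter_def)

lemma ultra: "ultrafilter U"
  using free by (simp add: free_ultrafilter_def)

text \<open>Kronecker's theorem is applied to the elements \<open>f \<xi> n\<close> together with the generators in \<open>S\<close>.  Of the finitely
many relations to be excluded, those that involve only generators in \<open>S\<close> never hold, and each of the others fails
for \<open>U\<close>-almost all \<open>n\<close> by independence.  On \<open>S\<close> the approximation can be turned from one modulo 1 into one of real
numbers, because integer shifts of \<open>\<phi>\<close> change the values of \<open>lin \<phi>\<close> by integers.  The quantifiers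
over \<open>\<phi>0\<close> and \<open>t\<close> stand inside that over \<open>n\<close>, which makes it possible to fix the good \<open>n\<close> before the characters.\<close>

lemma eventually_approximable:
  fixes \<epsilon> :: real
  assumes S: "finite S" and D: "finite D" "D \<subseteq> I" and \<epsilon>: "0 < \<epsilon>"
  shows "\<forall>\<^sub>F n in U. \<forall>\<phi>0 t. \<exists>\<phi>. (\<forall>c\<in>S. \<bar>\<phi> c - \<phi>0 c\<bar> < \<epsilon>) \<and>
    (\<forall>\<xi>\<in>D. \<exists>p::int. \<bar>lin \<phi> (f \<xi> n) - t \<xi> - of_int p\<bar> < \<epsilon>)"
proof -
  define J :: "('c + 'c) set" where "J = D <+> S"
  have J: "finite J" using S D by (simp add: J_def)
  define v where "v n = case_sum (\<lambda>\<xi>. f \<xi> n) frag_of" for n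
  obtain N where N: "\<forall>v :: 'c + 'c \<Rightarrow> ('c \<Rightarrow>\<^sub>0 int).
      (\<forall>m. (\<forall>j\<in>J. \<bar>m j\<bar> \<le> int N) \<and> (\<Sum>j\<in>J. frag_cmul (m j) (v j)) = 0 \<longrightarrow> (\<forall>j\<in>J. m j = 0)) \<longrightarrow>
      (\<forall>t. \<exists>\<phi>. \<forall>j\<in>J. \<exists>p::int. \<bar>lin \<phi> (v j) - t j - of_int p\<bar> < \<epsilon>)"
    by (rule exE[OF quantitative_Kronecker[OF J \<epsilon>]])
  define M where "M = {m \<in> J \<rightarrow>\<^sub>E {- int N..int N}. \<exists>j\<in>J. m j \<noteq> 0}"
  have "finite M" unfolding M_def using J by (intro finite_subset[OF Collect_restrict] finite_PiE) auto
  have split: "(\<Sum>j\<in>J. frag_cmul (m j) (v n j)) =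
      frag_extend (\<lambda>\<xi>. f \<xi> n) (\<Sum>\<xi>\<in>D. frag_cmul (m (Inl \<xi>)) (frag_of \<xi>)) +
      (\<Sum>c\<in>S. frag_cmul (m (Inr c)) (frag_of c))" for m n
    using S D by (simp add: J_def v_def sum.Plus frag_extend_sum frag_extend_cmul o_def)
  have "\<forall>\<^sub>F n in U. (\<Sum>j\<in>J. frag_cmul (m j) (v n j)) \<noteq> 0" if m: "m \<in> M" for m
  proof -
    let ?r = "\<Sum>\<xi>\<in>D. frag_cmul (m (Inl \<xi>)) (frag_of \<xi>)"
    let ?s = "\<Sum>c\<in>S. frag_cmul (m (Inr c)) (frag_of c)"
    show ?thesis
    proof (cases "?r = 0")
      case True
      have "m (Inl \<xi>) = 0" if "\<xi> \<in> D" for \<xi>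
        using arg_cong[OF True, of "\<lambda>x. Poly_Mapping.lookup x \<xi>"] that D(1)
        by (simp add: lookup_sum_frag_cmul_frag_of)
      then obtain c where c: "c \<in> S" "m (Inr c) \<noteq> 0" using m by (auto simp: M_def J_def)
      have "?s \<noteq> 0"
      proof
        assume "?s = 0"
        from arg_cong[OF this, of "\<lambda>x. Poly_Mapping.lookup x c"] c S show False
          by (simp add: lookup_sum_frag_cmul_frag_of)
      qed
      then show ?thesis unfolding split True by simp
    next
      case False
      have "Poly_Mapping.keys ?r \<subseteq> I"
      proof
        fix \<xi> assume "\<xi> \<in> Poly_Mapping.keys ?r"
        then have "Poly_Mapping.lookup ?r \<xi> \<noteq> 0" unfolding in_keys_iff .
        then have "\<xi> \<in> D" by (metis lookup_sum_frag_cmul_frag_of[OF D(1)])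
        then show "\<xi> \<in> I" using D(2) by blast
      qed
      from indep[OF this False, of "- ?s"] show ?thesis
        unfolding split by (simp add: eq_neg_iff_add_eq_0)
    qed
  qed
  then have "\<forall>\<^sub>F n in U. \<forall>m\<in>M. (\<Sum>j\<in>J. frag_cmul (m j) (v n j)) \<noteq> 0"
    using \<open>finite M\<close> by (simp add: eventually_ball_finite)
  then show ?thesis
  proof (rule eventually_mono, intro allI)
    fix n and \<phi>0 t :: "'c \<Rightarrow> real"
    assume n: "\<forall>m\<in>M. (\<Sum>j\<in>J. frag_cmul (m j) (v n j)) \<noteq> 0"
    have small_relations: "\<forall>j\<in>J. m j = 0" if m: "\<forall>j\<in>J. \<bar>m j\<bar> \<le> int N" "(\<Sum>j\<in>J. frag_cmul (m j) (v n j)) = 0" for m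
    proof -
      have "(\<Sum>j\<in>J. frag_cmul (restrict m J j) (v n j)) = 0"
        using m(2) by simp
      then have "restrict m J \<notin> M" using n by blast
      moreover have "restrict m J \<in> J \<rightarrow>\<^sub>E {- int N..int N}" using m(1) by (auto simp: abs_le_iff)
      ultimately show ?thesis by (auto simp: M_def)
    qed
    have "\<forall>t. \<exists>\<phi>. \<forall>j\<in>J. \<exists>p::int. \<bar>lin \<phi> (v n j) - t j - of_int p\<bar> < \<epsilon>"
      by (rule N[THEN spec, THEN mp]) (use small_relations in blast)
    then obtain \<phi>' where \<phi>': "\<forall>j\<in>J. \<exists>p::int. \<bar>lin \<phi>' (v n j) - case_sum t \<phi>0 j - of_int p\<bar> < \<epsilon>"
      by blast
    have "\<forall>c\<in>S. \<exists>p::int. \<bar>\<phi>' c - \<phi>0 c - of_int p\<bar> < \<epsilon>"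
    proof
      fix c assume "c \<in> S"
      then have "Inr c \<in> J" unfolding J_def by (rule InrI)
      with \<phi>' show "\<exists>p::int. \<bar>\<phi>' c - \<phi>0 c - of_int p\<bar> < \<epsilon>" by (force simp: v_def)
    qed
    then obtain p :: "'c \<Rightarrow> int" where p: "\<And>c. c \<in> S \<Longrightarrow> \<bar>\<phi>' c - \<phi>0 c - of_int (p c)\<bar> < \<epsilon>" by metis
    define p' where "p' c = (if c \<in> S then p c else 0)" for c
    define \<phi> where "\<phi> c = \<phi>' c - of_int (p' c)" for c
    have lin_\<phi>: "lin \<phi> x = lin \<phi>' x - of_int (\<Sum>c\<in>Poly_Mapping.keys x. Poly_Mapping.lookup x c * p' c)" for x
      by (simp add: lin_def \<phi>_def right_diff_distrib sum_subtractf)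
    show "\<exists>\<phi>. (\<forall>c\<in>S. \<bar>\<phi> c - \<phi>0 c\<bar> < \<epsilon>) \<and> (\<forall>\<xi>\<in>D. \<exists>p::int. \<bar>lin \<phi> (f \<xi> n) - t \<xi> - of_int p\<bar> < \<epsilon>)"
    proof (rule exI[of _ \<phi>], intro conjI ballI)
      fix c assume "c \<in> S"
      then show "\<bar>\<phi> c - \<phi>0 c\<bar> < \<epsilon>" using p[of c] by (simp add: \<phi>_def p'_def algebra_simps)
    next
      fix \<xi> assume "\<xi> \<in> D"
      then have "Inl \<xi> \<in> J" unfolding J_def by (rule InlI)
      with \<phi>' obtain q :: int where "\<bar>lin \<phi>' (f \<xi> n) - t \<xi> - of_int q\<bar> < \<epsilon>" by (force simp: v_def)
      then have "\<bar>lin \<phi> (f \<xi> n) - t \<xi> -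
          of_int (q - (\<Sum>c\<in>Poly_Mapping.keys (f \<xi> n). Poly_Mapping.lookup (f \<xi> n) c * p' c))\<bar> < \<epsilon>"
        unfolding lin_\<phi> of_int_diff by (simp add: algebra_simps)
      then show "\<exists>p::int. \<bar>lin \<phi> (f \<xi> n) - t \<xi> - of_int p\<bar> < \<epsilon>" ..
    qed
  qed
qed

text \<open>Stage \<open>n\<close> takes care of the first \<open>n + 1\<close> generators in an enumeration of \<open>E\<close> and of the first \<open>n + 1\<close> terms
of the sequences attached to these.  The tolerance \<open>\<epsilon> n\<close> is at least halved from stage to
stage and is divided by one plus the sum \<open>L n\<close> of the norms of \<open>e\<close> and of these terms, so the total of the
later corrections changes the character at these elements by at most \<open>2 * (1/2) ^ n / 8\<close>.
Along an enumeration \<open>a\<close> of a set in \<open>U\<close> with \<open>a (Suc k)\<close> good for stage \<open>a k\<close>, the character \<open>\<phi> (Suc k)\<close>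
is obtained from \<open>\<phi> k\<close> by taking the current values \<open>\<phi> k \<xi>\<close> as the targets at \<open>f \<xi> (a (Suc k))\<close>.\<close>

lemma countable_character:
  assumes E: "countable E" "Poly_Mapping.keys e \<subseteq> E" and e: "e \<noteq> 0"
  shows "\<exists>\<psi>. \<psi> \<in> compatible U (E \<inter> I) f \<and> circ (lin \<psi> e) \<noteq> 1"
proof -
  obtain c0 where c0: "c0 \<in> Poly_Mapping.keys e" using e by (metis equals0I keys_eq_empty)
  then have "E \<noteq> {}" using E(2) by auto
  define c where "c = from_nat_into E"
  have c: "range c = E" using E(1) \<open>E \<noteq> {}\<close> by (simp add: c_def)
  define D where "D n = I \<inter> c ` {..n}" for n
  define S where "S n = Poly_Mapping.keys e \<union> c ` {..n} \<union> (\<Union>\<xi>\<in>D n. \<Union>m\<le>n. Poly_Mapping.keys (f \<xi> m))" for n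
  define L where "L n = l1 e + (\<Sum>\<xi>\<in>D n. \<Sum>m\<le>n. l1 (f \<xi> m))" for n
  define \<epsilon> where "\<epsilon> n = (1/2) ^ n / (8 * (1 + L n))" for n
  have finD: "finite (D n)" and finS: "finite (S n)" for n by (auto simp: D_def S_def)
  have D_mono: "D m \<subseteq> D n" if "m \<le> n" for m n using that by (auto simp: D_def)
  have S_mono: "S m \<subseteq> S n" if "m \<le> n" for m n
    using that D_mono[OF that] unfolding S_def by (fastforce simp: subset_iff)
  have L_nonneg: "0 \<le> L n" for n by (auto simp: L_def intro!: add_nonneg_nonneg sum_nonneg l1_nonneg)
  have L_mono: "L m \<le> L n" if "m \<le> n" for m n
  proof -
    have "(\<Sum>\<xi>\<in>D m. \<Sum>i\<le>m. l1 (f \<xi> i)) \<le> (\<Sum>\<xi>\<in>D m. \<Sum>i\<le>n. l1 (f \<xi> i))"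
      using that by (intro sum_mono sum_mono2) (auto simp: l1_nonneg)
    also have "\<dots> \<le> (\<Sum>\<xi>\<in>D n. \<Sum>i\<le>n. l1 (f \<xi> i))"
      using D_mono[OF that] finD by (intro sum_mono2) (auto simp: l1_nonneg sum_nonneg)
    finally show ?thesis by (simp add: L_def)
  qed
  have \<epsilon>_pos: "0 < \<epsilon> n" for n using L_nonneg[of n] by (simp add: \<epsilon>_def)
  have \<epsilon>_half: "\<epsilon> n \<le> \<epsilon> m / 2" if "m < n" for m n
  proof -
    have "\<epsilon> n \<le> (1/2) ^ Suc m / (8 * (1 + L m))"
      unfolding \<epsilon>_def using that L_mono[of m n] L_nonneg[of m]
      by (intro frac_le power_decreasing) auto
    then show ?thesis by (simp add: \<epsilon>_def)
  qed
  have \<epsilon>_mult: "y * \<epsilon> n \<le> (1/2) ^ n / 8" if "0 \<le> y" "y \<le> 1 + L n" for y n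
  proof -
    have "y * \<epsilon> n \<le> (1 + L n) * \<epsilon> n" using that \<epsilon>_pos[of n] by (intro mult_right_mono) auto
    also have "\<dots> = (1/2) ^ n / 8"
    proof -
      define q where "q = 1 + L n"
      have "q \<noteq> 0" using L_nonneg[of n] by (simp add: q_def)
      then show ?thesis by (simp add: \<epsilon>_def q_def[symmetric])
    qed
    finally show ?thesis .
  qed
  define B where "B n = {k. \<forall>\<phi>0 t. \<exists>\<phi>. (\<forall>c\<in>S n. \<bar>\<phi> c - \<phi>0 c\<bar> < \<epsilon> n) \<and>
    (\<forall>\<xi>\<in>D n. \<exists>p::int. \<bar>lin \<phi> (f \<xi> k) - t \<xi> - of_int p\<bar> < \<epsilon> n)}" for n
  have "\<forall>\<^sub>F k in U. k \<in> B n" for n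
    unfolding B_def mem_Collect_eq
    by (rule eventually_approximable) (auto simp: finS finD \<epsilon>_pos, auto simp: D_def)
  then obtain A where A: "\<forall>\<^sub>F k in U. k \<in> A" and A_B: "\<And>a b. a \<in> A \<Longrightarrow> b \<in> A \<Longrightarrow> a < b \<Longrightarrow> b \<in> B a"
    using selective_ultrafilter_diagonal_intersection[OF sel] by blast
  have "infinite A"
  proof
    assume "finite A"
    from free_ultrafilter_eventually_notin_finite[OF free this] A have "\<forall>\<^sub>F n in U. False"
      by eventually_elim simp
    then show False using ultra by (simp add: ultrafilter_def)
  qed
  define a where "a = enumerate A"
  have a_mem: "a k \<in> A" for k using \<open>infinite A\<close> by (simp add: a_def enumerate_in_set)
  have a_mono: "strict_mono a" using \<open>infinite A\<close> by (simp add: a_def strict_mono_enumerate)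
  have a_B: "a (Suc k) \<in> B (a k)" for k
    using a_mem a_mono by (intro A_B) (auto simp: strict_mono_Suc_iff)
  \<comment> \<open>The initial character takes the value \<open>1/2\<close> at \<open>e\<close>; all corrections together change it by at most \<open>1/4\<close>.\<close>
  define \<phi>0 where "\<phi>0 = (\<lambda>d. if d = c0 then 1 / (2 * of_int (Poly_Mapping.lookup e c0)) else (0::real))"
  define Q where "Q k \<phi> \<phi>' \<longleftrightarrow> (\<forall>c\<in>S (a k). \<bar>\<phi>' c - \<phi> c\<bar> < \<epsilon> (a k)) \<and>
    (\<forall>\<xi>\<in>D (a k). \<exists>p::int. \<bar>lin \<phi>' (f \<xi> (a (Suc k))) - \<phi> \<xi> - of_int p\<bar> < \<epsilon> (a k))" for k and \<phi> \<phi>' :: "'c \<Rightarrow> real"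
  have "\<exists>\<phi>'. Q k \<phi> \<phi>'" for k \<phi>
    using a_B[of k] unfolding B_def Q_def by blast
  then have "\<exists>\<phi>. \<forall>k. (k = 0 \<longrightarrow> \<phi> k = \<phi>0) \<and> Q k (\<phi> k) (\<phi> (Suc k))"
    by (intro dependent_nat_choice) auto
  then obtain \<phi> where \<phi>_0: "\<phi> 0 = \<phi>0" and Q: "\<And>k. Q k (\<phi> k) (\<phi> (Suc k))" by auto
  have a_le: "a i \<le> a j" if "i \<le> j" for i j using a_mono that by (simp add: strict_mono_less_eq)
  have "\<exists>l. \<forall>k. d \<in> S (a k) \<longrightarrow> \<bar>l - \<phi> k d\<bar> \<le> 2 * \<epsilon> (a k)" for d
  proof (cases "\<exists>k. d \<in> S (a k)")
    case True
    define k where "k = (LEAST k. d \<in> S (a k))"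
    have k: "d \<in> S (a k)" and least: "d \<in> S (a i) \<Longrightarrow> k \<le> i" for i
      using True unfolding k_def by (auto intro: LeastI_ex Least_le)
    have "\<exists>l. \<forall>i\<ge>k. \<bar>l - \<phi> i d\<bar> \<le> 2 * \<epsilon> (a i)"
    proof (rule geometric_steps_limit)
      fix i assume "k \<le> i"
      then have "d \<in> S (a i)" using k S_mono[OF a_le] by blast
      then show "\<bar>\<phi> (Suc i) d - \<phi> i d\<bar> \<le> \<epsilon> (a i)" using Q[of i] unfolding Q_def by fastforce
    next
      show "\<epsilon> (a (Suc i)) \<le> \<epsilon> (a i) / 2" for i using a_mono by (intro \<epsilon>_half) (simp add: strict_mono_Suc_iff)
      show "0 \<le> \<epsilon> (a i)" for i using \<epsilon>_pos[of "a i"] by simp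
    qed
    with least show ?thesis by blast
  qed auto
  then obtain \<psi> where \<psi>: "\<And>d k. d \<in> S (a k) \<Longrightarrow> \<bar>\<psi> d - \<phi> k d\<bar> \<le> 2 * \<epsilon> (a k)" by metis
  have "circ (lin \<psi> e) \<noteq> 1"
  proof -
    have "lin \<phi>0 e = (\<Sum>d\<in>{c0}. of_int (Poly_Mapping.lookup e d) * \<phi>0 d)"
      unfolding lin_def using c0 by (intro sum.mono_neutral_right) (auto simp: \<phi>0_def)
    then have half: "lin \<phi>0 e = 1 / 2" using c0 by (simp add: \<phi>0_def in_keys_iff)
    have "\<bar>lin \<psi> e - lin (\<phi> 0) e\<bar> \<le> l1 e * (2 * \<epsilon> (a 0))"
      by (rule lin_approx, rule \<psi>) (auto simp: S_def)
    also have "\<dots> = 2 * (l1 e * \<epsilon> (a 0))" by simp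
    also have "\<dots> \<le> 2 * ((1/2) ^ a 0 / 8)"
      by (intro mult_left_mono \<epsilon>_mult) (auto simp: l1_nonneg L_def intro!: add_increasing2 sum_nonneg)
    also have "\<dots> \<le> 1 / 4" using power_le_one[of "1/2::real" "a 0"] by simp
    finally have near: "\<bar>lin \<psi> e - 1 / 2\<bar> \<le> 1 / 4" by (simp add: \<phi>_0 half)
    have "lin \<psi> e \<noteq> of_int p" for p :: int
    proof
      assume "lin \<psi> e = of_int p"
      with near have "0 < real_of_int p" "real_of_int p < 1" by linarith+
      then show False by simp
    qed
    then show ?thesis unfolding circ_eq_1_iff by blast
  qed
  moreover have "\<psi> \<in> compatible U (E \<inter> I) f"
    unfolding compatible_def
  proof (intro CollectI ballI tendsto_circ_mod_1)
    fix \<xi> and \<delta> :: real assume \<xi>: "\<xi> \<in> E \<inter> I" and "0 < \<delta>"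
    then obtain i where i: "\<xi> = c i" using c by auto
    obtain j where j: "(1/2) ^ j < \<delta>" using real_arch_pow_inv[OF \<open>0 < \<delta>\<close>, of "1/2"] by auto
    show "\<forall>\<^sub>F n in U. \<exists>p::int. \<bar>lin \<psi> (f \<xi> n) - \<psi> \<xi> - of_int p\<bar> < \<delta>"
      using A free_ultrafilter_eventually_notin_finite[OF free finite_atMost[of "a (i + j)"]]
    proof eventually_elim
      case (elim n)
      then obtain k' where k': "n = a k'" using enumerate_Ex[OF \<open>infinite A\<close>] by (metis a_def)
      with elim have "\<not> a k' \<le> a (i + j)" by simp
      then have "i + j < k'" by (simp add: strict_mono_less_eq[OF a_mono])
      then obtain k where k: "k' = Suc k" "i + j \<le> k" by (cases k') auto
      have "k \<le> a k" using a_mono by (rule strict_mono_imp_increasing)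
      with k have ak: "i \<le> a k" "j \<le> a k" by auto
      then have \<xi>_D: "\<xi> \<in> D (a k)" using \<xi> i by (auto simp: D_def)
      then obtain p :: int where p: "\<bar>lin (\<phi> (Suc k)) (f \<xi> n) - \<phi> k \<xi> - of_int p\<bar> < \<epsilon> (a k)"
        using Q[of k] unfolding Q_def k' k(1) by blast
      have \<xi>_D': "\<xi> \<in> D n" using \<xi>_D D_mono[OF a_le[of k "Suc k"]] k' k(1) by auto
      have "\<bar>lin \<psi> (f \<xi> n) - lin (\<phi> (Suc k)) (f \<xi> n)\<bar> \<le> l1 (f \<xi> n) * (2 * \<epsilon> n)"
      proof (rule lin_approx)
        fix d assume "d \<in> Poly_Mapping.keys (f \<xi> n)"
        then have "d \<in> S n" using \<xi>_D' by (auto simp: S_def)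
        then show "\<bar>\<psi> d - \<phi> (Suc k) d\<bar> \<le> 2 * \<epsilon> n" using \<psi>[of d "Suc k"] k' k(1) by simp
      qed
      also have "\<dots> = 2 * (l1 (f \<xi> n) * \<epsilon> n)" by simp
      also have "l1 (f \<xi> n) * \<epsilon> n \<le> (1/2) ^ n / 8"
      proof (rule \<epsilon>_mult)
        have "l1 (f \<xi> n) \<le> (\<Sum>m\<le>n. l1 (f \<xi> m))"
          by (rule member_le_sum) (auto simp: l1_nonneg)
        also have "\<dots> \<le> (\<Sum>\<xi>\<in>D n. \<Sum>m\<le>n. l1 (f \<xi> m))"
          using \<xi>_D' finD by (intro member_le_sum[of \<xi> "D n" "\<lambda>\<xi>. \<Sum>m\<le>n. l1 (f \<xi> m)"]) (auto intro: sum_nonneg l1_nonneg)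
        also have "\<dots> \<le> 1 + L n" using l1_nonneg[of e] by (simp add: L_def)
        finally show "l1 (f \<xi> n) \<le> 1 + L n" .
      qed (rule l1_nonneg)
      finally have 1: "\<bar>lin \<psi> (f \<xi> n) - lin (\<phi> (Suc k)) (f \<xi> n)\<bar> \<le> 2 * ((1/2) ^ n / 8)" by simp
      have "\<xi> \<in> S (a k)" using ak(1) i by (auto simp: S_def)
      then have 2: "\<bar>\<psi> \<xi> - \<phi> k \<xi>\<bar> \<le> 2 * \<epsilon> (a k)" by (rule \<psi>)
      have 3: "\<epsilon> (a k) \<le> (1/2) ^ a k / 8" using \<epsilon>_mult[of 1 "a k"] L_nonneg[of "a k"] by simp
      have 4: "(1/2::real) ^ n \<le> (1/2) ^ a k" using k' k(1) a_le[of k "Suc k"] by (intro power_decreasing) auto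
      have 5: "(1/2::real) ^ a k \<le> (1/2) ^ j" using ak(2) by (intro power_decreasing) auto
      have combine: "\<bar>x - z - q\<bar> < t"
        if "\<bar>y - w - q\<bar> < d" "\<bar>x - y\<bar> \<le> 2 * (u / 8)" "\<bar>z - w\<bar> \<le> 2 * d" "d \<le> t / 8" "u \<le> t" "0 < t"
        for x y z w q d t u :: real
        using that by linarith
      have "\<bar>lin \<psi> (f \<xi> n) - \<psi> \<xi> - of_int p\<bar> < (1/2) ^ a k"
        by (rule combine[OF p 1 2 3 4]) simp
      with 5 j show ?case by (intro exI[of _ p]) linarith
    qed
  qed
  ultimately show ?thesis by blast
qed

text \<open>Outside \<open>E\<close> the value at \<open>\<xi>\<close> is defined by the limit condition; the limit exists as the circle is
compact, and it involves only values below \<open>\<xi>\<close>.\<close>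

lemma extend_character:
  assumes \<psi>: "\<psi> \<in> compatible U (E \<inter> I) f"
    and closed: "\<And>\<xi> n. \<xi> \<in> E \<inter> I \<Longrightarrow> Poly_Mapping.keys (f \<xi> n) \<subseteq> E"
  shows "\<exists>\<phi>\<in>compatible U I f. \<forall>c\<in>E. \<phi> c = \<psi> c"
proof -
  define P where "P \<phi> \<xi> r \<longleftrightarrow> (if \<xi> \<in> E then r = \<psi> \<xi> else
    \<xi> \<in> I \<longrightarrow> ((\<lambda>n. circ (lin \<phi> (f \<xi> n))) \<longlongrightarrow> circ r) U)" for \<phi> :: "'c \<Rightarrow> real" and \<xi> r
  have "\<exists>\<phi>. \<forall>\<xi>. P \<phi> \<xi> (\<phi> \<xi>)"
  proof (rule dependent_wf_choice[OF wf])
    fix \<phi> \<phi>' :: "'c \<Rightarrow> real" and \<xi> r assume eq: "\<And>\<eta>. (\<eta>, \<xi>) \<in> R \<Longrightarrow> \<phi> \<eta> = \<phi>' \<eta>"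
    have "lin \<phi> (f \<xi> n) = lin \<phi>' (f \<xi> n)" if "\<xi> \<in> I" for n
      using keys_f[OF that] eq by (intro lin_cong) blast
    then show "P \<phi> \<xi> r = P \<phi>' \<xi> r" by (simp add: P_def)
  next
    fix \<xi> and \<phi> :: "'c \<Rightarrow> real"
    obtain l where l: "cmod l = 1" "((\<lambda>n. circ (lin \<phi> (f \<xi> n))) \<longlongrightarrow> l) U"
      using ultrafilter_compact_limit[OF ultra compact_sphere[of 0 1], of "\<lambda>n. circ (lin \<phi> (f \<xi> n))"]
      by auto
    then have "l \<noteq> 0" by auto
    then have "circ (Arg l / (2 * pi)) = l" using l(1) by (simp add: cis_Arg sgn_div_norm)
    with l(2) show "\<exists>r. P \<phi> \<xi> r" by (metis P_def)
  qed
  then obtain \<phi> where \<phi>: "\<And>\<xi>. P \<phi> \<xi> (\<phi> \<xi>)" by blast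
  then have \<phi>_E: "\<phi> \<xi> = \<psi> \<xi>" if "\<xi> \<in> E" for \<xi> using that by (metis P_def)
  have "((\<lambda>n. circ (lin \<phi> (f \<xi> n))) \<longlongrightarrow> circ (\<phi> \<xi>)) U" if \<xi>: "\<xi> \<in> I" for \<xi>
  proof (cases "\<xi> \<in> E")
    case True
    then have "lin \<phi> (f \<xi> n) = lin \<psi> (f \<xi> n)" for n
      using closed[of \<xi> n] \<xi> \<phi>_E by (intro lin_cong) auto
    with True \<xi> \<psi> \<phi>_E show ?thesis by (simp add: compatible_def)
  next
    case False
    with \<phi>[of \<xi>] \<xi> show ?thesis by (simp add: P_def)
  qed
  with \<phi>_E show ?thesis by (auto simp: compatible_def)
qed

text \<open>The support of \<open>e\<close> lies in a countable set of generators that is closed under passing to the supports of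
the attached sequences.  Closedness guarantees that extending a character beyond this set does not
disturb the limit conditions in it.\<close>

lemma compatible_separates:
  assumes "e \<noteq> 0"
  shows "\<exists>\<phi>\<in>compatible U I f. circ (lin \<phi> e) \<noteq> 1"
proof -
  define X where "X = {(\<xi>, \<eta>). \<xi> \<in> I \<and> (\<exists>n. \<eta> \<in> Poly_Mapping.keys (f \<xi> n))}"
  define E where "E = X\<^sup>* `` Poly_Mapping.keys e"
  have closed: "Poly_Mapping.keys (f \<xi> n) \<subseteq> E" if "\<xi> \<in> E \<inter> I" for \<xi> n
    using that by (auto simp: E_def X_def intro: rtrancl_into_rtrancl)
  have "countable E"
    unfolding E_def
  proof (rule countable_rtrancl)
    fix Y :: "'c set" assume "countable Y"
    have "X `` Y \<subseteq> (\<Union>\<xi>\<in>Y. \<Union>n. Poly_Mapping.keys (f \<xi> n))" by (auto simp: X_def)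
    then show "countable (X `` Y)"
      by (rule countable_subset) (intro countable_UN \<open>countable Y\<close> countable_finite finite_keys countableI_type)
  qed (simp add: countable_finite)
  moreover have "Poly_Mapping.keys e \<subseteq> E" by (auto simp: E_def)
  ultimately obtain \<psi> where \<psi>: "\<psi> \<in> compatible U (E \<inter> I) f" "circ (lin \<psi> e) \<noteq> 1"
    using countable_character[of E e] assms by blast
  obtain \<phi> where \<phi>: "\<phi> \<in> compatible U I f" "\<forall>c\<in>E. \<phi> c = \<psi> c"
    using extend_character[OF \<psi>(1) closed] by blast
  have eq: "lin \<phi> e = lin \<psi> e"
    using \<phi>(2) \<open>Poly_Mapping.keys e \<subseteq> E\<close> by (intro lin_cong) auto
  have "circ (lin \<phi> e) \<noteq> 1" unfolding eq by (rule \<psi>(2))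
  then show ?thesis using \<phi>(1) by (rule bexI)
qed

end
section \<open>Topologies induced by characters\<close>

definition character_topology :: "'c set \<Rightarrow> ('c \<Rightarrow> real) set \<Rightarrow> ('c \<Rightarrow>\<^sub>0 int) topology" where
  "character_topology C H = pullback_topology (carrier (free_Abelian_group C))
     (\<lambda>x. restrict (\<lambda>\<phi>. circ (lin \<phi> x)) H) (product_topology (\<lambda>_. euclidean) H)"

lemma topspace_character_topology [simp]:
  "topspace (character_topology C H) = carrier (free_Abelian_group C)"
  by (auto simp: character_topology_def topspace_pullback_topology)

lemma continuous_map_character_evaluation:
  "continuous_map (character_topology C H) (product_topology (\<lambda>_. euclidean) H)
     (\<lambda>x. restrict (\<lambda>\<phi>. circ (lin \<phi> x)) H)"
  using continuous_map_pullback[OF continuous_map_id] by (simp add: character_topology_def)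

lemma continuous_map_character:
  assumes "\<phi> \<in> H"
  shows "continuous_map (character_topology C H) euclidean (\<lambda>x. circ (lin \<phi> x))"
  using continuous_map_character_evaluation[of C H] assms
  by (simp add: continuous_map_componentwise)

lemma continuous_map_into_character_topology:
  assumes "\<And>x. x \<in> topspace X \<Longrightarrow> g x \<in> carrier (free_Abelian_group C)"
    and "\<And>\<phi>. \<phi> \<in> H \<Longrightarrow> continuous_map X euclidean (\<lambda>x. circ (lin \<phi> (g x)))"
  shows "continuous_map X (character_topology C H) g"
  unfolding character_topology_def
proof (rule continuous_map_pullback')
  show "continuous_map X (product_topology (\<lambda>_. euclidean) H) ((\<lambda>x. restrict (\<lambda>\<phi>. circ (lin \<phi> x)) H) \<circ> g)"
    using assms(2) by (auto simp: continuous_map_componentwise)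
qed (use assms(1) in auto)

lemma group_topology_character_topology:
  "group_topology (free_Abelian_group C) (character_topology C H)"
proof -
  let ?G = "free_Abelian_group C" and ?T = "character_topology C H"
  have "continuous_map (prod_topology ?T ?T) ?T (\<lambda>(x, y). x \<otimes>\<^bsub>?G\<^esub> y)"
  proof (rule continuous_map_into_character_topology)
    fix z assume "z \<in> topspace (prod_topology ?T ?T)"
    then show "(case z of (x, y) \<Rightarrow> x \<otimes>\<^bsub>?G\<^esub> y) \<in> carrier ?G"
      using group.is_monoid[OF group_free_Abelian_group[of C]]
      by (auto simp: case_prod_beta simp del: carrier_free_Abelian_group_iff mult_free_Abelian_group
          intro: monoid.m_closed)
  next
    fix \<phi> assume \<phi>: "\<phi> \<in> H"
    have "continuous_map (prod_topology ?T ?T) euclidean (\<lambda>z. circ (lin \<phi> (fst z)))"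
      "continuous_map (prod_topology ?T ?T) euclidean (\<lambda>z. circ (lin \<phi> (snd z)))"
      using continuous_map_compose[OF continuous_map_fst continuous_map_character[OF \<phi>], of C ?T]
        continuous_map_compose[OF continuous_map_snd continuous_map_character[OF \<phi>], of ?T C]
      by (simp_all only: o_def)
    then have "continuous_map (prod_topology ?T ?T) euclidean (\<lambda>z. circ (lin \<phi> (fst z)) * circ (lin \<phi> (snd z)))"
      unfolding continuous_map_atin limitin_canonical_iff by (intro ballI tendsto_mult) auto
    then show "continuous_map (prod_topology ?T ?T) euclidean
        (\<lambda>z. circ (lin \<phi> (case z of (x, y) \<Rightarrow> x \<otimes>\<^bsub>?G\<^esub> y)))"
      by (simp only: case_prod_beta mult_free_Abelian_group lin_add circ_add)
  qed
  moreover have "continuous_map ?T ?T (\<lambda>x. inv\<^bsub>?G\<^esub> x)"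
  proof (rule continuous_map_into_character_topology)
    fix x assume "x \<in> topspace ?T"
    then show "inv\<^bsub>?G\<^esub> x \<in> carrier ?G"
      using group.inv_closed[OF group_free_Abelian_group] by (simp only: topspace_character_topology)
  next
    fix \<phi> assume \<phi>: "\<phi> \<in> H"
    have "continuous_map euclidean euclidean cnj"
      unfolding continuous_map_iff_continuous2 by (intro continuous_intros)
    from continuous_map_compose[OF continuous_map_character[OF \<phi>] this]
    have "continuous_map ?T euclidean (\<lambda>x. cnj (circ (lin \<phi> x)))" by (simp only: o_def)
    then show "continuous_map ?T euclidean (\<lambda>x. circ (lin \<phi> (inv\<^bsub>?G\<^esub> x)))"
      by (rule continuous_map_eq) (auto simp: lin_minus cis_cnj)
  qed
  ultimately show ?thesis by (simp only: group_topology_def topspace_character_topology)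
qed

lemma Hausdorff_character_topology:
  assumes "\<And>e. e \<noteq> 0 \<Longrightarrow> \<exists>\<phi>\<in>H. circ (lin \<phi> e) \<noteq> 1"
  shows "Hausdorff_space (character_topology C H)"
proof (rule Hausdorff_space_injective_preimage[OF _ continuous_map_character_evaluation])
  show "Hausdorff_space (product_topology (\<lambda>_. euclidean :: complex topology) H)"
    by (simp add: Hausdorff_space_product_topology)
  show "inj_on (\<lambda>x. restrict (\<lambda>\<phi>. circ (lin \<phi> x)) H) (topspace (character_topology C H))"
  proof (rule inj_onI, rule ccontr)
    fix x y
    assume eq: "restrict (\<lambda>\<phi>. circ (lin \<phi> x)) H = restrict (\<lambda>\<phi>. circ (lin \<phi> y)) H" and "x \<noteq> y"
    then obtain \<phi> where \<phi>: "\<phi> \<in> H" "circ (lin \<phi> (x - y)) \<noteq> 1" using assms[of "x - y"] by auto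
    have "circ (lin \<phi> x) = circ (lin \<phi> y)"
      using fun_cong[OF eq, of \<phi>] \<phi>(1) by (simp only: restrict_apply' )
    then have "circ (lin \<phi> (x - y)) = circ (lin \<phi> y) * circ (- lin \<phi> y)"
      by (simp only: lin_diff circ_diff)
    also have "\<dots> = 1" by (simp only: circ_add[symmetric]) simp
    finally show False using \<phi>(2) by contradiction
  qed
qed

text \<open>An infinite set contains the range of an injective sequence, hence that of some \<open>f \<xi>\<close>; by
compatibility the generator \<open>\<xi>\<close> is its limit along \<open>U\<close>.\<close>

lemma countably_compact_character_topology:
  assumes U: "free_ultrafilter U" and I: "I \<subseteq> C"
    and cover: "\<And>g. inj g \<Longrightarrow> (\<And>n. Poly_Mapping.keys (g n) \<subseteq> C) \<Longrightarrow>
      \<exists>\<xi>\<in>I. \<exists>j :: nat \<Rightarrow> nat. inj j \<and> f \<xi> = g \<circ> j"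
  shows "countably_compact_space (character_topology C (compatible U I f))"
  unfolding countably_compact_space_def
proof (intro allI impI, elim conjE)
  let ?H = "compatible U I f"
  let ?ev = "\<lambda>x. restrict (\<lambda>\<phi>. circ (lin \<phi> x)) ?H"
  fix S assume S: "S \<subseteq> topspace (character_topology C ?H)" "infinite S"
  obtain g :: "nat \<Rightarrow> _" where g: "inj g" "range g \<subseteq> S"
    using infinite_countable_subset[OF S(2)] by blast
  have "Poly_Mapping.keys (g n) \<subseteq> C" for n
    using g(2) S(1) by (force simp: image_subset_iff)
  from cover[OF g(1) this] obtain \<xi> j where \<xi>: "\<xi> \<in> I" and j: "inj j" and f_eq: "f \<xi> = g \<circ> j" by blast
  have inj_f: "inj (f \<xi>)" unfolding f_eq using g(1) j by (rule inj_compose)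
  have f_S: "f \<xi> n \<in> S" for n using g(2) by (auto simp: f_eq)
  have nonconst: "\<forall>\<^sub>F n in U. f \<xi> n \<noteq> frag_of \<xi>"
  proof (cases "\<exists>m. f \<xi> m = frag_of \<xi>")
    case True
    then obtain m where m: "f \<xi> m = frag_of \<xi>" by blast
    from free_ultrafilter_eventually_neq[OF U, of m] show ?thesis
      by (rule eventually_mono) (metis m inj_f injD)
  qed simp
  have "frag_of \<xi> \<in> (character_topology C ?H) derived_set_of S"
    unfolding in_derived_set_of
  proof (intro conjI allI impI, goal_cases)
    case 1
    show ?case using \<xi> I by auto
  next
    case (2 W)
    then obtain V where V: "openin (product_topology (\<lambda>_. euclidean) ?H) V"
      and W: "W = ?ev -` V \<inter> carrier (free_Abelian_group C)"
      by (auto simp: character_topology_def openin_pullback_topology)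
    have "limitin (product_topology (\<lambda>_. euclidean) ?H) (\<lambda>n. ?ev (f \<xi> n)) (?ev (frag_of \<xi>)) U"
      unfolding limitin_componentwise using \<xi> by (auto simp: compatible_def limitin_canonical_iff)
    then have "\<forall>\<^sub>F n in U. ?ev (f \<xi> n) \<in> V" using V 2 W by (auto simp: limitin_def)
    with nonconst have "\<forall>\<^sub>F n in U. f \<xi> n \<noteq> frag_of \<xi> \<and> f \<xi> n \<in> W"
    proof eventually_elim
      case (elim n)
      have "f \<xi> n \<in> carrier (free_Abelian_group C)"
        using f_S[of n] S(1) unfolding topspace_character_topology by (rule subsetD[rotated])
      with elim W show ?case by (simp only: Int_iff vimage_eq simp_thms)
    qed
    moreover have "U \<noteq> bot" using U by (simp add: free_ultrafilter_def ultrafilter_def)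
    ultimately obtain n where "f \<xi> n \<noteq> frag_of \<xi>" "f \<xi> n \<in> W" using eventually_happens by blast
    with f_S[of n] show ?case by blast
  qed
  then show "(character_topology C ?H) derived_set_of S \<noteq> {}" by blast
qed

section \<open>Countably compact topologies on free Abelian groups\<close>

theorem theorem2p7:
  fixes C :: "'c set"
  assumes "\<exists>U. selective_ultrafilter U"
    and "C \<approx> (UNIV :: real set)"
  shows "\<exists>T. group_topology (free_Abelian_group C) T \<and> Hausdorff_space T \<and> countably_compact_space T"
proof -
  obtain U where U: "selective_ultrafilter U" using assms(1) by blast
  then have free: "free_ultrafilter U" by (simp add: selective_ultrafilter_def)
  have C: "C \<approx> (UNIV :: nat set set)"
    using assms(2) nat_sets_eqpoll_reals by (meson eqpoll_sym eqpoll_trans)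
  show ?thesis
  proof (rule exists_independent_family[OF free C])
    fix R :: "('c \<times> 'c) set" and I and f :: "'c \<Rightarrow> nat \<Rightarrow> ('c \<Rightarrow>\<^sub>0 int)"
    assume "wf R" and I: "I \<subseteq> C"
      and keys: "\<And>\<xi> n \<eta>. \<xi> \<in> I \<Longrightarrow> \<eta> \<in> Poly_Mapping.keys (f \<xi> n) \<Longrightarrow> (\<eta>, \<xi>) \<in> R"
      and indep: "\<And>r s. Poly_Mapping.keys r \<subseteq> I \<Longrightarrow> r \<noteq> 0 \<Longrightarrow>
        \<forall>\<^sub>F n in U. frag_extend (\<lambda>\<xi>. f \<xi> n) r \<noteq> s"
      and cover: "\<And>g. inj g \<Longrightarrow> (\<And>n. Poly_Mapping.keys (g n) \<subseteq> C) \<Longrightarrow>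
        \<exists>\<xi>\<in>I. \<exists>j :: nat \<Rightarrow> nat. inj j \<and> f \<xi> = g \<circ> j"
    interpret independent_sequences U R I f
      using U \<open>wf R\<close> keys indep by (rule independent_sequences.intro)
    let ?T = "character_topology C (compatible U I f)"
    have "Hausdorff_space ?T"
      using compatible_separates by (rule Hausdorff_character_topology)
    moreover have "countably_compact_space ?T"
      using free I cover by (rule countably_compact_character_topology)
    ultimately show ?thesis
      using group_topology_character_topology by blast
  qed
qed

end
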